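(* Assume (RHS.1), (RHS.2b) (i.e., $f\equiv0$), (BC.1), (BC.2), that condition (M.1) holds for the discretization parameters in use, and that there is $\alpha\in(0,1]$ with $g\in C^{0,\alpha}(\partial\Omega)$ and such that the viscosity solution $u$ of $-\Delta^\diamond_\infty u=0$ in $\Omega$, $u=g$ on $\partial\Omega$ satisfies $u\in C^{0,\alpha}(\overline\Omega)$. Let $u_{\mathfrak h}$ be the solution of the discrete problem. If $\mathfrak h=(h,\varepsilon,\theta)$ is sufficiently small, $\varepsilon-\varepsilon\theta-h>0$, and $(2h+\varepsilon\theta)/\varepsilon^2$ is sufficiently small, then $$\|u-u_{\mathfrak h}\|_{L^\infty(\Omega_h)}\le C\Big(\varepsilon^\alpha+\frac{\sqrt{2h+\varepsilon\theta}}{\varepsilon}\Big),$$ where $C$ depends only on $d$, $\Omega$, the shape regularity of the family of meshes, and the $C^{0,\alpha}$ norms of $g$ and $u$.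
   Context: Setting: $\Omega\subset\mathbb R^d$ ($d\ge1$) is a bounded domain with continuous boundary. For $r>0$, $\Omega^{(r)}=\{x\in\Omega:\operatorname{dist}(x,\partial\Omega)>r\}$. $\{\mathcal T_h\}_{h>0}$ is a quasiuniform family of meshes of closed simplices, $h=\max_T\operatorname{diam}T$, $\Omega_h$ the interior of the union of the simplices, with $\Omega^{(h)}\subset\Omega_h\subset\Omega$; $\mathcal N_h$ is the set of vertices. $\mathbb V_h$ is the space of continuous piecewise linear functions on $\mathcal T_h$, with hat basis $\{\hat\varphi_z\}_{z\in\mathcal N_h}$, and $\mathcal I_h$ is the Lagrange interpolant. Parameters $\mathfrak h=(h,\varepsilon,\theta)$ with $\varepsilon\in[h,\operatorname{diam}\Omega]$, $0<\theta\le1$. Interior nodes $\mathcal N_h^I=\mathcal N_h\cap\Omega^{(2\varepsilon)}$; boundary nodes $\mathcal N_h^b=\mathcal N_h\setminus\mathcal N_h^I$. $\mathbb S_\theta$ is a finite symmetric subset of the unit sphere $\mathbb S$ such that each $v\in\mathbb S$ has $v_\theta\in\mathbb S_\theta$ with $|v-v_\theta|\le\theta$. For $z\in\mathcal N_h^I$, $\mathcal N_{\mathfrak h}(z)=\{z\}\cup\{z+\varepsilon v_\theta:v_\theta\in\mathbb S_\theta\}$, and for $w\in C(\overline\Omega)$, $-\Delta^\diamond_{\infty,\mathfrak h}w(z)=\varepsilon^{-2}\big(2w(z)-\max_{x\in\mathcal N_{\mathfrak h}(z)}\mathcal I_hw(x)-\min_{x\in\mathcal N_{\mathfrak h}(z)}\mathcal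 I_hw(x)\big)$. Also $\widetilde{\mathcal N}_{\mathfrak h}(z)=\{z\}\cup\{z'\in\mathcal N_h:\exists v_\theta\in\mathbb S_\theta,\ \hat\varphi_{z'}(z+\varepsilon v_\theta)>0\}$. Assumptions: (RHS.1) $f\in C(\Omega)\cap L^\infty(\Omega)$. (RHS.2b) $f\equiv0$. (BC.1) $g\in C(\partial\Omega)$. (BC.2) for every $\varepsilon>0$ a function $\tilde g_\varepsilon\in C(\overline\Omega)$ is given such that, if $g\in C^{0,\alpha}(\partial\Omega)$ for some $\alpha\in[0,1]$, then $\tilde g_\varepsilon\in C^{0,\alpha}(\overline\Omega)$ and $\|g-\tilde g_\varepsilon\|_{L^\infty(\partial\Omega)}\le C\varepsilon^\alpha$. (M.1): for every nonempty $S\subset\mathcal N_h^I$ there are $z\in S$ and $z'\in\mathcal N_h\setminus S$ with $z'\in\widetilde{\mathcal N}_{\mathfrak h}(z)$. Discrete problem: find $u_{\mathfrak h}\in\mathbb V_h$ with $-\Delta^\diamond_{\infty,\mathfrak h}u_{\mathfrak h}(z)=f(z)$, $z\in\mathcal N_h^I$, and $u_{\mathfrak h}(z)=\tilde g_\varepsilon(z)$, $z\in\mathcal N_h^b$. Continuous problem: $\Delta^\diamond_\infty\varphi=|D\varphi|^{-2}D\varphi^\intercal D^2\varphi D\varphi$ where $D\varphi\ne0$; $\Delta^\pm_\infty\varphi(x)$ equal this if $D\varphi(x)\ne0$ and $\lambda_{\max}$, resp. $\lambda_{\min}$, of $D^2\varphi(x)$ if $D\varphi(x)=0$. The viscosity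 solution $u\in C(\overline\Omega)$ satisfies $u=g$ on $\partial\Omega$ and, for all $x_0\in\Omega$, $\varphi\in C^2$: $u-\varphi$ local max at $x_0$ implies $-\Delta^+_\infty\varphi(x_0)\le f(x_0)$; $u-\varphi$ local min at $x_0$ implies $-\Delta^-_\infty\varphi(x_0)\ge f(x_0)$. It exists and is unique.
   Formalization: The extensions g̃_ε are assumed to have C^{0,α} norms bounded uniformly in ε, and C may depend on this bound and on the constant in (BC.2); without this, g̃_ε could be of size 1 at nodes in the 2ε boundary layer while g = u = 0, and the estimate fails. *)

theory Defs
  imports "HOL-Analysis.Analysis"
begin

text \<open>Bounded domain with continuous boundary: near each boundary point, after choosing a
unit direction v, the domain is the strict epigraph (in direction v) of a continuous function
of the component orthogonal to v.\<close>
definition continuous_boundary :: "(real^'n) set \<Rightarrow> bool" where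
  "continuous_boundary \<Omega> \<longleftrightarrow>
     (\<forall>x\<in>frontier \<Omega>. \<exists>r>0. \<exists>v \<gamma>. norm v = 1 \<and> continuous_on UNIV (\<gamma> :: real^'n \<Rightarrow> real) \<and>
        \<Omega> \<inter> ball x r = {y \<in> ball x r. y \<bullet> v > \<gamma> (y - (y \<bullet> v) *\<^sub>R v)})"

definition bounded_domain_cb :: "(real^'n) set \<Rightarrow> bool" where
  "bounded_domain_cb \<Omega> \<longleftrightarrow> open \<Omega> \<and> connected \<Omega> \<and> \<Omega> \<noteq> {} \<and> bounded \<Omega> \<and> continuous_boundary \<Omega>"

definition inner_set :: "(real^'n) set \<Rightarrow> real \<Rightarrow> (real^'n) set" where
  "inner_set \<Omega> r = {x \<in> \<Omega>. infdist x (frontier \<Omega>) > r}"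

text \<open>w restricted to S is bounded by M and has Hoelder-alpha seminorm at most M
(so the C^{0,alpha}(S) norm is at most 2M).\<close>
definition holder_bounded :: "(real^'n) set \<Rightarrow> real \<Rightarrow> real \<Rightarrow> (real^'n \<Rightarrow> real) \<Rightarrow> bool" where
  "holder_bounded S \<alpha> M w \<longleftrightarrow>
     continuous_on S w \<and> (\<forall>x\<in>S. \<bar>w x\<bar> \<le> M) \<and>
     (\<forall>x\<in>S. \<forall>y\<in>S. \<bar>w x - w y\<bar> \<le> M * dist x y powr \<alpha>)"

text \<open>A mesh is represented by the finite set of vertex sets of its closed simplices.\<close>
definition is_simplex_vertices :: "(real^'n) set \<Rightarrow> bool" where
  "is_simplex_vertices V \<longleftrightarrow> finite V \<and> card V = CARD('n) + 1 \<and> \<not> affine_dependent V"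

definition conforming_mesh :: "(real^'n) set set \<Rightarrow> bool" where
  "conforming_mesh \<T> \<longleftrightarrow> finite \<T> \<and> \<T> \<noteq> {} \<and> (\<forall>V\<in>\<T>. is_simplex_vertices V) \<and>
     (\<forall>V\<in>\<T>. \<forall>W\<in>\<T>. convex hull V \<inter> convex hull W = convex hull (V \<inter> W))"

definition mesh_size :: "(real^'n) set set \<Rightarrow> real" where
  "mesh_size \<T> = Max ((\<lambda>V. diameter (convex hull V)) ` \<T>)"

definition mesh_domain :: "(real^'n) set set \<Rightarrow> (real^'n) set" where
  "mesh_domain \<T> = interior (\<Union>V\<in>\<T>. convex hull V)"

definition mesh_nodes :: "(real^'n) set set \<Rightarrow> (real^'n) set" where
  "mesh_nodes \<T> = \<Union>\<T>"

definition shape_regular :: "real \<Rightarrow> (real^'n) set set \<Rightarrow> bool" where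
  "shape_regular \<sigma> \<T> \<longleftrightarrow>
     (\<forall>V\<in>\<T>. \<exists>c r. r > 0 \<and> ball c r \<subseteq> convex hull V \<and> diameter (convex hull V) \<le> \<sigma> * r)"

definition quasi_uniform :: "real \<Rightarrow> (real^'n) set set \<Rightarrow> bool" where
  "quasi_uniform q \<T> \<longleftrightarrow> (\<forall>V\<in>\<T>. diameter (convex hull V) \<ge> q * mesh_size \<T>)"

text \<open>Lagrange interpolant (continuous piecewise linear function with nodal values of w),
evaluated via barycentric coordinates on a simplex containing x.\<close>
definition interp :: "(real^'n) set set \<Rightarrow> (real^'n \<Rightarrow> real) \<Rightarrow> real^'n \<Rightarrow> real" where
  "interp \<T> w x = (SOME y. \<exists>V\<in>\<T>. \<exists>l. (\<forall>v\<in>V. l v \<ge> 0) \<and> sum l V = 1 \<and>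
       (\<Sum>v\<in>V. l v *\<^sub>R v) = x \<and> y = (\<Sum>v\<in>V. l v * w v))"

definition hat :: "(real^'n) set set \<Rightarrow> real^'n \<Rightarrow> real^'n \<Rightarrow> real" where
  "hat \<T> z = interp \<T> (\<lambda>y. if y = z then 1 else 0)"

definition direction_set :: "real \<Rightarrow> (real^'n) set \<Rightarrow> bool" where
  "direction_set \<theta> S \<longleftrightarrow> finite S \<and> S \<subseteq> sphere 0 1 \<and> (\<forall>v\<in>S. - v \<in> S) \<and>
     (\<forall>v\<in>sphere 0 1. \<exists>w\<in>S. norm (v - w) \<le> \<theta>)"

definition interior_nodes :: "(real^'n) set \<Rightarrow> (real^'n) set set \<Rightarrow> real \<Rightarrow> (real^'n) set" where
  "interior_nodes \<Omega> \<T> \<epsilon> = mesh_nodes \<T> \<inter> inner_set \<Omega> (2 * \<epsilon>)"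

definition boundary_nodes :: "(real^'n) set \<Rightarrow> (real^'n) set set \<Rightarrow> real \<Rightarrow> (real^'n) set" where
  "boundary_nodes \<Omega> \<T> \<epsilon> = mesh_nodes \<T> - interior_nodes \<Omega> \<T> \<epsilon>"

definition stencil :: "real \<Rightarrow> (real^'n) set \<Rightarrow> real^'n \<Rightarrow> (real^'n) set" where
  "stencil \<epsilon> S z = insert z ((\<lambda>v. z + \<epsilon> *\<^sub>R v) ` S)"

definition neg_disc_inf_lap ::
  "(real^'n) set set \<Rightarrow> real \<Rightarrow> (real^'n) set \<Rightarrow> (real^'n \<Rightarrow> real) \<Rightarrow> real^'n \<Rightarrow> real" where
  "neg_disc_inf_lap \<T> \<epsilon> S w z =
     (2 * w z - Max (interp \<T> w ` stencil \<epsilon> S z) - Min (interp \<T> w ` stencil \<epsilon> S z)) / \<epsilon>\<^sup>2"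

definition ext_stencil :: "(real^'n) set set \<Rightarrow> real \<Rightarrow> (real^'n) set \<Rightarrow> real^'n \<Rightarrow> (real^'n) set" where
  "ext_stencil \<T> \<epsilon> S z =
     insert z {z' \<in> mesh_nodes \<T>. \<exists>v\<in>S. hat \<T> z' (z + \<epsilon> *\<^sub>R v) > 0}"

definition cond_M1 :: "(real^'n) set \<Rightarrow> (real^'n) set set \<Rightarrow> real \<Rightarrow> (real^'n) set \<Rightarrow> bool" where
  "cond_M1 \<Omega> \<T> \<epsilon> S \<longleftrightarrow>
     (\<forall>A. A \<noteq> {} \<longrightarrow> A \<subseteq> interior_nodes \<Omega> \<T> \<epsilon> \<longrightarrow>
        (\<exists>z\<in>A. \<exists>z'\<in>mesh_nodes \<T> - A. z' \<in> ext_stencil \<T> \<epsilon> S z))"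

text \<open>Discrete problem: nodal values U with -Delta U(z) = f(z) on interior nodes and
U(z) = gt(z) on boundary nodes; the discrete solution is interp T U.\<close>
definition discrete_solution ::
  "(real^'n) set \<Rightarrow> (real^'n) set set \<Rightarrow> real \<Rightarrow> (real^'n) set \<Rightarrow> (real^'n \<Rightarrow> real)
     \<Rightarrow> (real^'n \<Rightarrow> real) \<Rightarrow> (real^'n \<Rightarrow> real) \<Rightarrow> bool" where
  "discrete_solution \<Omega> \<T> \<epsilon> S f gt U \<longleftrightarrow>
     (\<forall>z\<in>interior_nodes \<Omega> \<T> \<epsilon>. neg_disc_inf_lap \<T> \<epsilon> S U z = f z) \<and>
     (\<forall>z\<in>boundary_nodes \<Omega> \<T> \<epsilon>. U z = gt z)"

definition eigenvalues_mat :: "real^'n^'n \<Rightarrow> real set" where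
  "eigenvalues_mat A = {l. \<exists>v. v \<noteq> 0 \<and> A *v v = l *\<^sub>R v}"

definition lap_inf_plus :: "real^'n \<Rightarrow> real^'n^'n \<Rightarrow> real" where
  "lap_inf_plus p H = (if p \<noteq> 0 then (p \<bullet> (H *v p)) / (norm p)\<^sup>2 else Max (eigenvalues_mat H))"

definition lap_inf_minus :: "real^'n \<Rightarrow> real^'n^'n \<Rightarrow> real" where
  "lap_inf_minus p H = (if p \<noteq> 0 then (p \<bullet> (H *v p)) / (norm p)\<^sup>2 else Min (eigenvalues_mat H))"

definition C2_on :: "(real^'n) set \<Rightarrow> (real^'n \<Rightarrow> real) \<Rightarrow> (real^'n \<Rightarrow> real^'n) \<Rightarrow> (real^'n \<Rightarrow> real^'n^'n) \<Rightarrow> bool" where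
  "C2_on S \<phi> D D2 \<longleftrightarrow> open S \<and>
     (\<forall>x\<in>S. (\<phi> has_derivative (\<lambda>k. D x \<bullet> k)) (at x) \<and> (D has_derivative (\<lambda>k. D2 x *v k)) (at x)) \<and>
     continuous_on S D2"

definition viscosity_solution ::
  "(real^'n) set \<Rightarrow> (real^'n \<Rightarrow> real) \<Rightarrow> (real^'n \<Rightarrow> real) \<Rightarrow> (real^'n \<Rightarrow> real) \<Rightarrow> bool" where
  "viscosity_solution \<Omega> f g u \<longleftrightarrow>
     continuous_on (closure \<Omega>) u \<and> (\<forall>x\<in>frontier \<Omega>. u x = g x) \<and>
     (\<forall>x0\<in>\<Omega>. \<forall>\<phi> D D2. C2_on \<Omega> \<phi> D D2 \<longrightarrow>
        ((\<exists>r>0. \<forall>x\<in>\<Omega> \<inter> ball x0 r. u x - \<phi> x \<le> u x0 - \<phi> x0) \<longrightarrow>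
            - lap_inf_plus (D x0) (D2 x0) \<le> f x0) \<and>
        ((\<exists>r>0. \<forall>x\<in>\<Omega> \<inter> ball x0 r. u x - \<phi> x \<ge> u x0 - \<phi> x0) \<longrightarrow>
            - lap_inf_minus (D x0) (D2 x0) \<ge> f x0))"

end

theory Submission
  imports Defs
begin

text \<open>A viscosity solution u of the infinity Laplace equation enjoys comparison with cones from above.
On the region where its local slope is below a threshold \<open>\<gamma>\<close> it is replaced by the eikonal function of
slope \<open>\<gamma>\<close>. The patched function v still enjoys comparison with cones from above, differs from u by at
most \<open>2 * \<gamma>\<close> times the diameter of the domain, and grows by at least \<open>\<gamma> * b\<close> on every ball of radius b.
The maxima w of v over balls of radius \<open>\<epsilon> + h\<close> therefore satisfy the discrete equation up to an excess of
order \<open>(2 * h + \<epsilon> * \<theta>) / \<epsilon>\<close> times the discrete slope. The second-order gain of the convex function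
\<open>w + \<gamma> * w\<^sup>2\<close> beats this excess as soon as \<open>\<gamma>\<^sup>2\<close> exceeds a multiple of \<open>(2 * h + \<epsilon> * \<theta>) / \<epsilon>\<^sup>2\<close>, so that this
function is a strict discrete subsolution, and a maximum of its difference to the discrete solution is
attained at a boundary node. The other inequality follows by applying this to \<open>- u\<close>.\<close>

section \<open>Comparison with cones\<close>

text \<open>The obstacle is the set where u is nearly constant. The excess of the discrete weight
  over 1/2 costs a multiple of the increment of w across the stencil, while convexity gains only a
  multiple of the square of that increment; without a lower bound on the increment the gain can be
  arbitrarily small compared with the cost. This is why the slope is forced to be at least \<gamma>:
  the increment is then at least of order \<gamma> \<epsilon>, and with the coefficient \<gamma> in
  front of the square the gain exceeds the cost. The same \<gamma> is the price paid, since patching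
  and squaring both perturb u by a multiple of \<gamma>. The choice of \<gamma> at the threshold, of
  order sqrt (2h + \<epsilon>\<theta>) / \<epsilon>, is the second term of the rate. Hoelder
  regularity enters only when u is compared with its values at distance O(\<epsilon>), which yields
  the first term; the equation itself is used only through comparison with cones, so that no
  derivative of u ever occurs.\<close>

definition inf_subharmonic :: "(real^'n) set \<Rightarrow> (real^'n \<Rightarrow> real) \<Rightarrow> bool" where
  "inf_subharmonic \<Omega> u \<longleftrightarrow> continuous_on \<Omega> u \<and>
     (\<forall>x\<in>\<Omega>. \<forall>\<phi> D D2. C2_on \<Omega> \<phi> D D2 \<and> D x \<noteq> 0 \<and>
        (\<exists>r>0. \<forall>y\<in>\<Omega> \<inter> ball x r. u y - \<phi> y \<le> u x - \<phi> x) \<longrightarrow> 0 \<le> D x \<bullet> (D2 x *v D x))"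

text \<open>Where the gradient of the test function does not vanish, both one-sided Laplacians are
  the same quotient with a positive denominator, so only the sign of the quadratic form remains. For
  \<open>- u\<close> the test function is negated: a local maximum of -u - \<phi> is a local minimum
  of u - (-\<phi>), and two of the three sign changes in the form cancel.\<close>

lemma viscosity_solution_inf_subharmonic:
  assumes "viscosity_solution \<Omega> (\<lambda>_. 0) g u"
  shows "inf_subharmonic (\<Omega> :: (real^'n) set) u" and "inf_subharmonic \<Omega> (\<lambda>x. - u x)"
proof -
  have vs: "((\<exists>r>0. \<forall>y\<in>\<Omega> \<inter> ball x r. u y - \<phi> y \<le> u x - \<phi> x) \<longrightarrow>
        - lap_inf_plus (D x) (D2 x) \<le> 0) \<and>
      ((\<exists>r>0. \<forall>y\<in>\<Omega> \<inter> ball x r. u y - \<phi> y \<ge> u x - \<phi> x) \<longrightarrow>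
        - lap_inf_minus (D x) (D2 x) \<ge> 0)"
    if "x \<in> \<Omega>" "C2_on \<Omega> \<phi> D D2" for x \<phi> and D :: "real^'n \<Rightarrow> real^'n" and D2
    using assms[unfolded viscosity_solution_def, THEN conjunct2, THEN conjunct2,
        THEN bspec, THEN spec, THEN spec, THEN spec, THEN mp] that by this
  have c: "continuous_on \<Omega> u"
    using assms[unfolded viscosity_solution_def, THEN conjunct1] closure_subset
    by (rule continuous_on_subset)
  show "inf_subharmonic \<Omega> u"
    unfolding inf_subharmonic_def
  proof (intro conjI c ballI allI impI; elim conjE)
    fix x \<phi> and D :: "real^'n \<Rightarrow> real^'n" and D2
    assume a: "x \<in> \<Omega>" "C2_on \<Omega> \<phi> D D2" "D x \<noteq> 0"
      "\<exists>r>0. \<forall>y\<in>\<Omega> \<inter> ball x r. u y - \<phi> y \<le> u x - \<phi> x"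
    then have "- lap_inf_plus (D x) (D2 x) \<le> 0"
      using vs[OF a(1,2)] a(4) by argo
    then show "0 \<le> D x \<bullet> (D2 x *v D x)"
      using a(3) by (simp add: lap_inf_plus_def zero_le_divide_iff)
  qed
  show "inf_subharmonic \<Omega> (\<lambda>x. - u x)"
    unfolding inf_subharmonic_def
  proof (intro conjI continuous_intros c ballI allI impI; elim conjE)
    fix x \<phi> and D :: "real^'n \<Rightarrow> real^'n" and D2
    assume a: "x \<in> \<Omega>" "C2_on \<Omega> \<phi> D D2" "D x \<noteq> 0"
      "\<exists>r>0. \<forall>y\<in>\<Omega> \<inter> ball x r. - u y - \<phi> y \<le> - u x - \<phi> x"
    have mv: "(- A) *v k = - (A *v k)" for A :: "real^'n^'n" and k
      by (simp add: matrix_vector_mult_def vec_eq_iff sum_negf)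
    have "((\<lambda>y. - \<phi> y) has_derivative (\<lambda>k. (- D y) \<bullet> k)) (at y)"
      "((\<lambda>y. - D y) has_derivative (\<lambda>k. (- D2 y) *v k)) (at y)" if "y \<in> \<Omega>" for y
      using a(2) that has_derivative_minus[of \<phi>] has_derivative_minus[of D] unfolding C2_on_def
      by (auto simp: mv)
    then have "C2_on \<Omega> (\<lambda>y. - \<phi> y) (\<lambda>y. - D y) (\<lambda>y. - D2 y)"
      using a(2) unfolding C2_on_def by (intro conjI ballI continuous_intros) blast+
    moreover have "\<exists>r>0. \<forall>y\<in>\<Omega> \<inter> ball x r. u y - (- \<phi> y) \<ge> u x - (- \<phi> x)"
    proof -
      obtain r where r: "r > 0" "\<forall>y\<in>\<Omega> \<inter> ball x r. - u y - \<phi> y \<le> - u x - \<phi> x"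
        using a(4) by blast
      have "u y - (- \<phi> y) \<ge> u x - (- \<phi> x)" if "y \<in> \<Omega> \<inter> ball x r" for y
        using r(2)[rule_format, OF that] by linarith
      then show ?thesis using r(1) by blast
    qed
    ultimately have "- lap_inf_minus (- D x) (- D2 x) \<ge> 0"
      using vs[OF a(1)] by blast
    moreover have "(- D x) \<bullet> ((- D2 x) *v (- D x)) = - (D x \<bullet> (D2 x *v D x))"
      by (simp add: mv matrix_vector_mult_def inner_vec_def sum_negf)
    ultimately show "0 \<le> D x \<bullet> (D2 x *v D x)"
      using a(3) by (simp add: lap_inf_minus_def zero_le_divide_iff)
  qed
qed

lemma inf_subharmonicD:
  assumes "inf_subharmonic \<Omega> u" "x \<in> \<Omega>" "C2_on \<Omega> \<phi> D D2" "D x \<noteq> 0" "r > 0"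
    and "\<And>y. y \<in> \<Omega> \<inter> ball x r \<Longrightarrow> u y - \<phi> y \<le> u x - \<phi> x"
  shows "0 \<le> D x \<bullet> (D2 x *v D x)"
  using assms(1)[unfolded inf_subharmonic_def, THEN conjunct2, THEN bspec, OF assms(2), THEN spec,
      THEN spec, THEN spec, THEN mp] assms(3-) by blast

text \<open>Test functions have to be of class C2 on all of \<Omega>, the vertex x included;
  \<open>k > 0\<close> rounds off the vertex. The rank-one matrix in the Hessian isolates the
  direction of the ray through x.\<close>

lemma C2_on_smoothed_cone:
  fixes x :: "real^'n"
  assumes "open \<Omega>" "k > 0"
  defines "s \<equiv> \<lambda>y. sqrt (k\<^sup>2 + (y - x) \<bullet> (y - x))"
  shows "C2_on \<Omega> (\<lambda>y. b * s y - \<eta> * ((y - x) \<bullet> (y - x)))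
    (\<lambda>y. (b / s y - 2 * \<eta>) *\<^sub>R (y - x))
    (\<lambda>y. (b / s y - 2 * \<eta>) *\<^sub>R mat 1 - (b / s y ^ 3) *\<^sub>R (\<chi> i j. (y - x) $ i * (y - x) $ j))"
proof -
  have pos: "k\<^sup>2 + (y - x) \<bullet> (y - x) > 0" for y
    using assms(2) by (simp add: add_pos_nonneg)
  have spos: "s y > 0" for y
    using pos by (simp add: s_def)
  have ds: "(s has_derivative (\<lambda>h. ((y - x) \<bullet> h) / s y)) (at y)" for y
    unfolding s_def
    using pos[of y] by (auto intro!: derivative_eq_intros simp: inner_commute field_simps)
  have outer: "(\<chi> i j. (y $ i - x $ i) * (y $ j - x $ j)) *v h = ((y - x) \<bullet> h) *\<^sub>R (y - x)" for y h
    by (simp add: vec_eq_iff matrix_vector_mult_def inner_vec_def sum_distrib_left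
        mult.assoc mult.commute mult.left_commute)
  have cs: "continuous_on \<Omega> s"
    unfolding s_def by (intro continuous_intros)
  show ?thesis
    unfolding C2_on_def
  proof (intro conjI ballI)
    fix y
    show "((\<lambda>y. b * s y - \<eta> * ((y - x) \<bullet> (y - x))) has_derivative
        (\<lambda>h. ((b / s y - 2 * \<eta>) *\<^sub>R (y - x)) \<bullet> h)) (at y)"
      by (rule derivative_eq_intros ds refl)+ (auto simp: fun_eq_iff inner_commute algebra_simps diff_divide_distrib add_divide_distrib)
    show "((\<lambda>y. (b / s y - 2 * \<eta>) *\<^sub>R (y - x)) has_derivative
        (\<lambda>h. ((b / s y - 2 * \<eta>) *\<^sub>R mat 1 - (b / s y ^ 3) *\<^sub>R (\<chi> i j. (y - x) $ i * (y - x) $ j)) *v h)) (at y)"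
      using spos[of y]
      by - ((rule derivative_eq_intros ds refl | simp)+,
         simp add: matrix_vector_mult_diff_rdistrib outer fun_eq_iff power3_eq_cube divide_simps
           flip: scaleR_matrix_vector_assoc)
  next
    show "continuous_on \<Omega> (\<lambda>y. (b / s y - 2 * \<eta>) *\<^sub>R mat 1 - (b / s y ^ 3) *\<^sub>R (\<chi> i j. (y - x) $ i * (y - x) $ j))"
      using spos by (intro continuous_intros cs) (auto simp: less_imp_neq[THEN not_sym])
  qed (use assms in auto)
qed

text \<open>The test function is a smoothed cone made strictly concave along rays: away from the vertex it
  violates the inequality for infinity-subharmonic functions.\<close>
lemma smoothed_cone_no_local_max:
  fixes x :: "real^'n"
  assumes sub: "inf_subharmonic \<Omega> u" and "open \<Omega>" "k > 0"
    and p: "p \<in> \<Omega>" "p \<noteq> x"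
    and b: "2 * \<eta> * sqrt (k\<^sup>2 + (norm (p - x))\<^sup>2) < b"
    and neg: "b * k\<^sup>2 < 2 * \<eta> * (norm (p - x)) ^ 3" and "\<eta> > 0" "r > 0"
    and lmax: "\<And>y. y \<in> \<Omega> \<inter> ball p r \<Longrightarrow>
      u y - (b * sqrt (k\<^sup>2 + (norm (y - x))\<^sup>2) - \<eta> * (norm (y - x))\<^sup>2) \<le>
      u p - (b * sqrt (k\<^sup>2 + (norm (p - x))\<^sup>2) - \<eta> * (norm (p - x))\<^sup>2)"
  shows False
proof -
  define s where "s = sqrt (k\<^sup>2 + (norm (p - x))\<^sup>2)"
  define c where "c = b / s - 2 * \<eta>"
  define P where "P = (\<chi> i j. (p - x) $ i * (p - x) $ j)"
  define H where "H = c *\<^sub>R mat 1 - (b / s ^ 3) *\<^sub>R P"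
  have s2: "s\<^sup>2 = k\<^sup>2 + (norm (p - x))\<^sup>2"
    unfolding s_def by simp
  have s: "s > 0" "norm (p - x) \<le> s"
    using assms(3) by (auto simp: s_def add_pos_nonneg intro!: real_le_rsqrt)
  have c: "c > 0"
    using b s(1) unfolding s_def[symmetric] c_def by (simp add: field_simps)
  have C2: "C2_on \<Omega> (\<lambda>y. b * sqrt (k\<^sup>2 + (norm (y - x))\<^sup>2) - \<eta> * (norm (y - x))\<^sup>2)
    (\<lambda>y. (b / sqrt (k\<^sup>2 + (norm (y - x))\<^sup>2) - 2 * \<eta>) *\<^sub>R (y - x))
    (\<lambda>y. (b / sqrt (k\<^sup>2 + (norm (y - x))\<^sup>2) - 2 * \<eta>) *\<^sub>R mat 1 -
      (b / sqrt (k\<^sup>2 + (norm (y - x))\<^sup>2) ^ 3) *\<^sub>R (\<chi> i j. (y - x) $ i * (y - x) $ j))"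
    using C2_on_smoothed_cone[OF assms(2,3), where x=x and b=b and \<eta>=\<eta>] by (simp only: dot_square_norm)
  have "0 \<le> (c *\<^sub>R (p - x)) \<bullet> (H *v (c *\<^sub>R (p - x)))"
    unfolding c_def s_def H_def P_def
  proof (rule inf_subharmonicD[OF sub p(1) C2 _ \<open>r > 0\<close> lmax])
    show "(b / sqrt (k\<^sup>2 + (norm (p - x))\<^sup>2) - 2 * \<eta>) *\<^sub>R (p - x) \<noteq> 0"
      using c p(2) unfolding c_def s_def by simp
  qed
  moreover have "H *v (c *\<^sub>R (p - x)) = (c * (c - b * (norm (p - x))\<^sup>2 / s ^ 3)) *\<^sub>R (p - x)"
  proof -
    have "P *v (p - x) = (norm (p - x))\<^sup>2 *\<^sub>R (p - x)"
      unfolding P_def power2_norm_eq_inner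
      by (simp add: vec_eq_iff matrix_vector_mult_def inner_vec_def sum_distrib_left
          mult.assoc mult.commute mult.left_commute)
    moreover have "H *v (c *\<^sub>R d) = (c * (c - b * n / s ^ 3)) *\<^sub>R d" if "P *v d = n *\<^sub>R d" for d n
      using that unfolding H_def by (simp add: matrix_vector_mult_diff_rdistrib matrix_vector_mult_scaleR
          algebra_simps flip: scaleR_matrix_vector_assoc)
    ultimately show ?thesis
      by blast
  qed
  ultimately have "0 \<le> c * (c * (c - b * (norm (p - x))\<^sup>2 / s ^ 3)) * (norm (p - x))\<^sup>2"
    by (simp add: power2_norm_eq_inner mult_ac)
  then have "0 \<le> c - b * (norm (p - x))\<^sup>2 / s ^ 3"
    using c p(2) by (simp add: zero_le_mult_iff)
  \<comment> \<open>The left-hand side is the eigenvalue of \<open>H\<close> in the radial direction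
    \<open>p - x\<close>; smoothing contributes the positive part
    \<open>b * k\<^sup>2 / s ^ 3\<close>, which is small away from the vertex and is outweighed
    there by the concave term.\<close>
  also have "c - b * (norm (p - x))\<^sup>2 / s ^ 3 = b * k\<^sup>2 / s ^ 3 - 2 * \<eta>"
  proof -
    have "b / s = b * s\<^sup>2 / s ^ 3"
      using s(1) by (simp add: power2_eq_square power3_eq_cube)
    then show ?thesis
      unfolding c_def s2 by (simp add: add_divide_distrib distrib_left)
  qed
  finally have "2 * \<eta> * s ^ 3 \<le> b * k\<^sup>2"
    using s(1) by (simp add: field_simps)
  moreover have "2 * \<eta> * (norm (p - x)) ^ 3 \<le> 2 * \<eta> * s ^ 3"
    using s \<open>\<eta> > 0\<close> by (intro mult_left_mono power_mono) auto
  ultimately show False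
    using neg by linarith
qed

text \<open>If u exceeded the cone at \<open>y0\<close>, a cone of slightly larger slope b would
  still be exceeded there. Subtracting a smoothed version of it leaves a maximum p on the closed
  ball that is neither on the sphere, because \<open>b * R > A\<close>, nor near the vertex, by
  continuity of u at x. This is the situation excluded by
  \<open>smoothed_cone_no_local_max\<close>.\<close>

lemma inf_subharmonic_cone_above:
  fixes u :: "real^'n \<Rightarrow> real"
  assumes sub: "inf_subharmonic \<Omega> u" and "open \<Omega>" "cball x R \<subseteq> \<Omega>" "R > 0"
    and A: "\<And>y. y \<in> cball x R \<Longrightarrow> u y \<le> u x + A" and y0: "y0 \<in> cball x R"
  shows "u y0 \<le> u x + norm (y0 - x) / R * A"
proof (rule ccontr)
  assume viol0: "\<not> ?thesis"
  define r0 where "r0 = norm (y0 - x)"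
  have viol: "u y0 > u x + r0 / R * A"
    using viol0 by (simp add: r0_def)
  have A0: "A \<ge> 0"
    using A[of x] \<open>R > 0\<close> by simp
  have r0: "0 < r0" "r0 \<le> R"
    using viol y0 by (auto simp: r0_def dist_norm norm_minus_commute)
  \<comment> \<open>Half of the violation is spent on raising the slope from \<open>A / R\<close> to
    b; the other half m remains as the excess of u over the new cone at \<open>y0\<close>.\<close>
  define m where "m = (u y0 - u x - r0 / R * A) / 2"
  define b where "b = A / R + m / r0"
  have m: "m > 0"
    using viol by (simp add: m_def)
  have b: "b > 0" "b * R > A"
    using m r0(1) A0 \<open>R > 0\<close> by (auto simp: b_def distrib_right add_nonneg_pos)
  have "b * r0 = r0 / R * A + m"
    using r0(1) by (simp add: b_def distrib_right)
  then have um: "u y0 = u x + b * r0 + m"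
    unfolding m_def by (simp add: field_simps)
  have cont: "continuous_on \<Omega> u"
    using sub unfolding inf_subharmonic_def by blast
  have xin: "x \<in> \<Omega>"
    using assms(3,4) by auto
  have "isCont u x"
    using cont xin \<open>open \<Omega>\<close> by (simp add: continuous_on_eq_continuous_at)
  then obtain d where d: "d > 0" "\<And>y. dist y x < d \<Longrightarrow> dist (u y) (u x) < m / 2"
    unfolding continuous_at_eps_delta using m by (metis half_gt_zero)
  \<comment> \<open>The order of choices matters: \<eta> makes the concave term cost at most m/8
    without reversing the slope, and k is taken afterwards, small relative to both \<eta> and the
    distance d that p will keep from the vertex.\<close>
  define \<eta> where "\<eta> = min (m / (8 * R\<^sup>2)) (b / (8 * R))"
  have eta: "\<eta> > 0" "\<eta> * R\<^sup>2 \<le> m / 8" "\<eta> * R \<le> b / 8"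
    using m b(1) \<open>R > 0\<close> by (auto simp: \<eta>_def min_def field_simps power2_eq_square)
  have "\<forall>\<^sub>F k in at_right 0. b * k < m / 4"
    using m by (intro order_tendstoD(2)[where y="b * 0"] tendsto_intros) auto
  moreover have "\<forall>\<^sub>F k in at_right 0. b * k\<^sup>2 < 2 * \<eta> * d ^ 3"
    using eta(1) d(1) by (intro order_tendstoD(2)[where y="b * 0\<^sup>2"] tendsto_intros) auto
  moreover have "\<forall>\<^sub>F k in at_right 0. k < R"
    using \<open>R > 0\<close> by (intro order_tendstoD(2)[where y=0] tendsto_intros) auto
  ultimately have "\<forall>\<^sub>F k in at_right 0. k > 0 \<and> b * k < m / 4 \<and> b * k\<^sup>2 < 2 * \<eta> * d ^ 3 \<and> k < R"
    using eventually_at_right_less[of 0] by eventually_elim auto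
  then obtain k where k: "k > 0" "b * k < m / 4" "b * k\<^sup>2 < 2 * \<eta> * d ^ 3" "k < R"
    using eventually_happens' trivial_limit_at_right_real by blast
  define \<phi> where "\<phi> = (\<lambda>y. b * sqrt (k\<^sup>2 + (norm (y - x))\<^sup>2) - \<eta> * (norm (y - x))\<^sup>2)"
  have "continuous_on (cball x R) (\<lambda>y. u y - \<phi> y)"
    unfolding \<phi>_def by (intro continuous_intros continuous_on_subset[OF cont assms(3)])
  then obtain p where p: "p \<in> cball x R" "\<And>y. y \<in> cball x R \<Longrightarrow> u y - \<phi> y \<le> u p - \<phi> p"
    using continuous_attains_sup[of "cball x R" "\<lambda>y. u y - \<phi> y"] \<open>R > 0\<close> by auto
  have pR: "norm (p - x) \<le> R"
    using p(1) by (simp add: dist_norm norm_minus_commute)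
  have etar: "\<eta> * (norm (p - x))\<^sup>2 \<le> m / 8"
    using eta(1,2) pR by (smt (verit, best) mult_left_mono norm_ge_zero power_mono)
  have phi0: "\<phi> y0 \<le> b * (k + r0)"
  proof -
    have "sqrt (k\<^sup>2 + r0\<^sup>2) \<le> k + r0"
      using k(1) r0(1) sqrt_add_le_add_sqrt[of "k\<^sup>2" "r0\<^sup>2"] by simp
    then have "b * sqrt (k\<^sup>2 + r0\<^sup>2) \<le> b * (k + r0)"
      using b(1) by (intro mult_left_mono) auto
    then show ?thesis
      using eta(1) unfolding \<phi>_def r0_def[symmetric] by (smt (verit) zero_le_mult_iff zero_le_power2)
  qed
  have phip: "\<phi> p \<ge> b * norm (p - x) - m / 8"
  proof -
    have "norm (p - x) \<le> sqrt (k\<^sup>2 + (norm (p - x))\<^sup>2)"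
      by (intro real_le_rsqrt) simp
    then have "b * norm (p - x) \<le> b * sqrt (k\<^sup>2 + (norm (p - x))\<^sup>2)"
      using b(1) by (intro mult_left_mono) auto
    then show ?thesis
      using etar unfolding \<phi>_def by linarith
  qed
  \<comment> \<open>Of the excess m, rounding takes less than m/4 and the concave term at most m/8.
    The remaining 5m/8 exceeds the oscillation m/2 of u within distance d of x, which forces p away
    from the vertex.\<close>
  have gap: "u p > u x + m * 5 / 8 + b * norm (p - x)"
    using p(2)[OF y0] phi0 phip k(2) um unfolding distrib_left by linarith
  have pd: "norm (p - x) \<ge> d"
  proof (rule ccontr)
    assume "\<not> ?thesis"
    then have "dist (u p) (u x) < m / 2"
      by (intro d(2)) (simp add: dist_norm)
    then have "u p < u x + m / 2"
      unfolding dist_real_def by linarith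
    moreover have "0 \<le> b * norm (p - x)"
      using b(1) by simp
    ultimately show False
      using gap m by linarith
  qed
  have "norm (p - x) \<noteq> R"
    using gap A[OF p(1)] b(2) m by (auto simp: mult.commute)
  then have pball: "p \<in> ball x R"
    using pR by (simp add: dist_norm norm_minus_commute)
  then obtain r where r: "r > 0" "ball p r \<subseteq> ball x R"
    using open_contains_ball open_ball by metis
  have "d ^ 3 \<le> (norm (p - x)) ^ 3"
    using pd d(1) by (intro power_mono) auto
  then have neg: "b * k\<^sup>2 < 2 * \<eta> * (norm (p - x)) ^ 3"
    using k(3) eta(1) by (smt (verit) mult_left_mono)
  have "sqrt (k\<^sup>2 + (norm (p - x))\<^sup>2) \<le> k + norm (p - x)"
    using k(1) sqrt_add_le_add_sqrt[of "k\<^sup>2" "(norm (p - x))\<^sup>2"] by simp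
  also have "\<dots> \<le> 2 * R"
    using k(4) pR by simp
  finally have "2 * \<eta> * sqrt (k\<^sup>2 + (norm (p - x))\<^sup>2) \<le> 2 * \<eta> * (2 * R)"
    using eta(1) by (intro mult_left_mono) auto
  then have slope: "2 * \<eta> * sqrt (k\<^sup>2 + (norm (p - x))\<^sup>2) < b"
  proof -
    have "2 * \<eta> * (2 * R) = 4 * (\<eta> * R)"
      by simp
    then show ?thesis
      using eta(3) b(1) \<open>2 * \<eta> * sqrt _ \<le> _\<close> by linarith
  qed
  show False
  proof (rule smoothed_cone_no_local_max[OF sub \<open>open \<Omega>\<close> k(1) _ _ slope neg eta(1) r(1)])
    show "p \<in> \<Omega>"
      using p(1) assms(3) by auto
    show "p \<noteq> x"
      using pd d(1) by auto
    show "u y - (b * sqrt (k\<^sup>2 + (norm (y - x))\<^sup>2) - \<eta> * (norm (y - x))\<^sup>2)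
      \<le> u p - (b * sqrt (k\<^sup>2 + (norm (p - x))\<^sup>2) - \<eta> * (norm (p - x))\<^sup>2)"
      if "y \<in> \<Omega> \<inter> ball p r" for y
      using p(2)[of y] that r(2) unfolding \<phi>_def by auto
  qed
qed

section \<open>Patching the region of small slope\<close>

text \<open>The set of t with \<open>k t \<le> k 0\<close> is compact, and its last point can only
  be 1, since the local condition leads from any earlier point to a later one in the set. This
  replaces integration of a slope bound along segments.\<close>

lemma continuous_le_if_locally_le:
  fixes k :: "real \<Rightarrow> real"
  assumes cont: "continuous_on {0..1} k"
    and loc: "\<And>t. 0 \<le> t \<Longrightarrow> t < 1 \<Longrightarrow> \<exists>s. t < s \<and> s \<le> 1 \<and> k s \<le> k t"
  shows "k 1 \<le> k 0"
proof -
  define S where "S = {t \<in> {0..1}. k t \<le> k 0}"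
  have "closed ({0..1} \<inter> k -` {..k 0})"
    by (intro continuous_closed_preimage cont closed_atLeastAtMost closed_atMost)
  moreover have "S = {0..1} \<inter> k -` {..k 0}"
    by (auto simp: S_def)
  ultimately have "compact S"
    using bounded_closed_interval[of 0 "1::real"] bounded_subset[of "{0..1}" S]
    by (auto simp: compact_eq_bounded_closed)
  moreover have "0 \<in> S"
    by (simp add: S_def)
  ultimately obtain T where T: "T \<in> S" "\<And>t. t \<in> S \<Longrightarrow> t \<le> T"
    using compact_attains_sup[of S] by auto
  have "T = 1"
  proof (rule ccontr)
    assume "T \<noteq> 1"
    then obtain s where "T < s" "s \<le> 1" "k s \<le> k T"
      using loc[of T] T(1) by (auto simp: S_def)
    then have "s \<in> S"
      using T(1) by (auto simp: S_def)
    then show False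
      using T(2) \<open>T < s\<close> by fastforce
  qed
  then show ?thesis
    using T(1) by (simp add: S_def)
qed

locale slope_patch =
  fixes \<Omega> :: "(real^'n) set" and u :: "real^'n \<Rightarrow> real" and \<gamma> :: real
  assumes open_dom: "open \<Omega>" and bounded_dom: "bounded \<Omega>"
    and cont: "continuous_on (closure \<Omega>) u"
    and sub: "inf_subharmonic \<Omega> u" and gamma_pos: "\<gamma> > 0"
begin

text \<open>The points at which the local slope of u is less than \<open>\<gamma>\<close>.\<close>
definition flat :: "(real^'n) set" where
  "flat = {x \<in> \<Omega>. \<exists>b>0. cball x b \<subseteq> \<Omega> \<and> (\<forall>p\<in>cball x b. u p < u x + \<gamma> * b)}"

lemma flat_subset: "flat \<subseteq> \<Omega>"
  by (auto simp: flat_def)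

lemma cont_dom: "continuous_on \<Omega> u"
  using cont closure_subset continuous_on_subset by blast

text \<open>The defining strict inequality leaves a positive margin on a compact ball, so it
  survives for every centre w near x on a slightly smaller ball; comparison with cones from w then
  turns this bound at one radius into a slope below \<gamma> at all smaller radii. One r serves all
  such w, so two nearby points can exchange roles.\<close>

lemma flat_nhds:
  assumes "x \<in> flat"
  shows "\<exists>r>0. \<forall>w\<in>ball x r. w \<in> flat \<and> (\<forall>p\<in>cball w r. p \<noteq> w \<longrightarrow> u p < u w + \<gamma> * norm (p - w))"
proof -
  obtain b where b: "b > 0" "cball x b \<subseteq> \<Omega>" "\<And>p. p \<in> cball x b \<Longrightarrow> u p < u x + \<gamma> * b"
    using assms by (auto simp: flat_def)
  obtain pm where pm: "pm \<in> cball x b" "\<And>p. p \<in> cball x b \<Longrightarrow> u p \<le> u pm"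
    using continuous_attains_sup[of "cball x b" u] continuous_on_subset[OF cont_dom b(2)] b(1) by auto
  \<comment> \<open>One half of the margin pays for the change from \<open>u x\<close> to
    \<open>u w\<close>, the other for shrinking the radius from b to \<open>b - r\<close>.\<close>
  define \<mu> where "\<mu> = u x + \<gamma> * b - u pm"
  have mu: "\<mu> > 0"
    using b(3)[OF pm(1)] by (simp add: \<mu>_def)
  have "isCont u x"
    using cont_dom open_dom assms flat_subset by (auto simp: continuous_on_eq_continuous_at)
  then obtain d where d: "d > 0" "\<And>y. dist y x < d \<Longrightarrow> dist (u y) (u x) < \<mu> / 2"
    unfolding continuous_at_eps_delta using mu by (metis half_gt_zero)
  define r where "r = min d (min (b / 2) (\<mu> / (2 * \<gamma>)))"
  have r: "r > 0" "r \<le> d" "r \<le> b / 2" "\<gamma> * r \<le> \<mu> / 2"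
  proof -
    have "r \<le> \<mu> / (2 * \<gamma>)"
      by (simp add: r_def)
    then show "\<gamma> * r \<le> \<mu> / 2"
      using gamma_pos by (simp add: field_simps)
  qed (use d(1) b(1) mu gamma_pos in \<open>auto simp: r_def\<close>)
  have "w \<in> flat \<and> (\<forall>p\<in>cball w r. p \<noteq> w \<longrightarrow> u p < u w + \<gamma> * norm (p - w))"
    if w: "w \<in> ball x r" for w
  proof -
    define A where "A = u pm - u w"
    have "dist (u w) (u x) < \<mu> / 2"
      using w r(2) by (intro d(2)) (auto simp: dist_commute)
    then have "u w > u x - \<mu> / 2"
      unfolding dist_real_def by linarith
    then have A: "A < \<gamma> * (b - r)"
    proof -
      have "u pm = u x + \<gamma> * b - \<mu>"
        by (simp add: \<mu>_def)
      then show ?thesis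
        using r(4) \<open>u w > _\<close> unfolding A_def right_diff_distrib by linarith
    qed
    have sub_ball: "cball w (b - r) \<subseteq> cball x b"
    proof
      fix p assume "p \<in> cball w (b - r)"
      then show "p \<in> cball x b"
        using w dist_triangle[of x p w] by auto
    qed
    have uA: "u p \<le> u w + A" if "p \<in> cball w (b - r)" for p
      using pm(2)[of p] that sub_ball by (auto simp: A_def)
    have br: "b - r > 0" "r \<le> b - r"
      using r b(1) by auto
    have "w \<in> flat"
    proof -
      have "w \<in> cball w (b - r)"
        using br(1) by simp
      then have "w \<in> \<Omega>"
        using sub_ball b(2) by blast
      moreover have "u p < u w + \<gamma> * (b - r)" if "p \<in> cball w (b - r)" for p
        using uA[OF that] A by linarith
      ultimately show ?thesis
        unfolding flat_def using br(1) order_trans[OF sub_ball b(2)] by blast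
    qed
    moreover have "u p < u w + \<gamma> * norm (p - w)" if "p \<in> cball w r" "p \<noteq> w" for p
    proof -
      have "u p \<le> u w + norm (p - w) / (b - r) * A"
      proof (rule inf_subharmonic_cone_above[OF sub open_dom _ br(1) uA])
        show "cball w (b - r) \<subseteq> \<Omega>" "p \<in> cball w (b - r)"
          using sub_ball b(2) that(1) br(2) by auto
      qed
      also have "norm (p - w) / (b - r) * A < norm (p - w) / (b - r) * (\<gamma> * (b - r))"
        using A br(1) that(2) by (intro mult_strict_left_mono) auto
      also have "\<dots> = \<gamma> * norm (p - w)"
        using br(1) by (simp add: field_simps)
      finally show ?thesis by simp
    qed
    ultimately show ?thesis by blast
  qed
  then show ?thesis
    using r(1) by blast
qed

lemma open_flat: "open flat"
  using flat_nhds by (meson openI open_contains_ball subsetI)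

text \<open>The end point q may lie outside \<open>flat\<close>, even on the frontier of \<Omega>;
  continuity of u on the closure carries the local slope bound up to it.\<close>

lemma flat_segment_le:
  assumes "\<And>t. 0 \<le> t \<Longrightarrow> t < 1 \<Longrightarrow> p + t *\<^sub>R (q - p) \<in> flat"
  shows "u q \<le> u p + \<gamma> * norm (q - p)" and "u p \<le> u q + \<gamma> * norm (q - p)"
proof -
  define \<sigma> where "\<sigma> = (\<lambda>t. p + t *\<^sub>R (q - p))"
  have sc: "continuous_on {0..1} \<sigma>"
    unfolding \<sigma>_def by (intro continuous_intros)
  have "\<sigma> ` {0..<1} \<subseteq> closure \<Omega>"
    using assms flat_subset closure_subset unfolding \<sigma>_def by fastforce
  then have "\<sigma> ` closure {0..<1} \<subseteq> closure \<Omega>"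
    using image_closure_subset[of "{0..<1}" \<sigma> "closure \<Omega>"] sc by simp
  then have "\<sigma> ` {0..1} \<subseteq> closure \<Omega>"
    by simp
  then have uc: "continuous_on {0..1} (\<lambda>t. u (\<sigma> t))"
    using continuous_on_compose2[OF cont sc] by blast
  have dsig: "norm (\<sigma> s - \<sigma> t) = \<bar>s - t\<bar> * norm (q - p)" for s t
    unfolding \<sigma>_def by (metis add_diff_cancel_left norm_scaleR scaleR_left_diff_distrib)
  have loc: "\<exists>s. t < s \<and> s \<le> 1 \<and> \<bar>u (\<sigma> s) - u (\<sigma> t)\<bar> \<le> \<gamma> * ((s - t) * norm (q - p))"
    if t: "0 \<le> t" "t < 1" for t
  proof -
    obtain r where r: "r > 0" and rr: "\<And>w x. w \<in> ball (\<sigma> t) r \<Longrightarrow> x \<in> cball w r \<Longrightarrow> x \<noteq> w \<Longrightarrow> u x < u w + \<gamma> * norm (x - w)"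
      using flat_nhds[OF assms[OF t]] unfolding \<sigma>_def by blast
    define s where "s = t + min (1 - t) (r / (2 * (1 + norm (q - p))))"
    have pos: "1 + norm (q - p) > 0"
      by (simp add: add_pos_nonneg)
    have s: "t < s" "s \<le> 1"
      using t r pos by (auto simp: s_def)
    have "(s - t) * norm (q - p) \<le> r / (2 * (1 + norm (q - p))) * (1 + norm (q - p))"
      using s(1) r pos by (intro mult_mono) (auto simp: s_def)
    also have "\<dots> = r / 2"
    proof -
      have "r / (2 * c) * c = r / 2" if "c > 0" for c
        using that by simp
      then show ?thesis
        using pos by blast
    qed
    also have "\<dots> < r"
      using r by simp
    finally have n: "norm (\<sigma> s - \<sigma> t) < r"
      using s(1) by (simp add: dsig)
    have "u (\<sigma> s) \<le> u (\<sigma> t) + \<gamma> * norm (\<sigma> s - \<sigma> t)"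
      using rr[of "\<sigma> t" "\<sigma> s"] n r by (cases "\<sigma> s = \<sigma> t") (auto simp: dist_norm norm_minus_commute)
    \<comment> \<open>Here the later point serves as the centre, which is possible because the
      radius r is uniform for centres near \<open>\<sigma> t\<close>.\<close>
    moreover have "u (\<sigma> t) \<le> u (\<sigma> s) + \<gamma> * norm (\<sigma> s - \<sigma> t)"
      using rr[of "\<sigma> s" "\<sigma> t"] n by (cases "\<sigma> s = \<sigma> t") (auto simp: dist_norm norm_minus_commute)
    ultimately have "\<bar>u (\<sigma> s) - u (\<sigma> t)\<bar> \<le> \<gamma> * ((s - t) * norm (q - p))"
      using s(1) by (simp add: dsig)
    then show ?thesis
      using s by blast
  qed
  have "u (\<sigma> 1) - \<gamma> * (1 * norm (q - p)) \<le> u (\<sigma> 0) - \<gamma> * (0 * norm (q - p))"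
  proof (rule continuous_le_if_locally_le[of "\<lambda>t. u (\<sigma> t) - \<gamma> * (t * norm (q - p))"])
    fix t :: real assume "0 \<le> t" "t < 1"
    then obtain s where "t < s" "s \<le> 1" "\<bar>u (\<sigma> s) - u (\<sigma> t)\<bar> \<le> \<gamma> * ((s - t) * norm (q - p))"
      using loc by blast
    then show "\<exists>s>t. s \<le> 1 \<and> u (\<sigma> s) - \<gamma> * (s * norm (q - p)) \<le> u (\<sigma> t) - \<gamma> * (t * norm (q - p))"
      by (intro exI[of _ s]) (auto simp: algebra_simps)
  qed (intro continuous_intros uc)
  then show "u q \<le> u p + \<gamma> * norm (q - p)"
    by (simp add: \<sigma>_def)
  have "- u (\<sigma> 1) - \<gamma> * (1 * norm (q - p)) \<le> - u (\<sigma> 0) - \<gamma> * (0 * norm (q - p))"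
  proof (rule continuous_le_if_locally_le[of "\<lambda>t. - u (\<sigma> t) - \<gamma> * (t * norm (q - p))"])
    fix t :: real assume "0 \<le> t" "t < 1"
    then obtain s where "t < s" "s \<le> 1" "\<bar>u (\<sigma> s) - u (\<sigma> t)\<bar> \<le> \<gamma> * ((s - t) * norm (q - p))"
      using loc by blast
    then show "\<exists>s>t. s \<le> 1 \<and> - u (\<sigma> s) - \<gamma> * (s * norm (q - p)) \<le> - u (\<sigma> t) - \<gamma> * (t * norm (q - p))"
      by (intro exI[of _ s]) (auto simp: algebra_simps)
  qed (intro continuous_intros uc)
  then show "u p \<le> u q + \<gamma> * norm (q - p)"
    by (simp add: \<sigma>_def)
qed

text \<open>This is the increasing slope estimate: slope at least \<gamma> is inherited by a maximum
  point on a ball. Stepping back from y towards x by a fraction t, comparison with cones from x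
  makes u drop by at least \<open>t * \<gamma> * b\<close>, whereas flatness at y would permit only
  a smaller drop.\<close>

lemma steep_max_not_flat:
  assumes x: "x \<in> \<Omega>" "x \<notin> flat" and b: "b > 0" "cball x b \<subseteq> \<Omega>"
    and y: "y \<in> cball x b" "\<And>p. p \<in> cball x b \<Longrightarrow> u p \<le> u y"
  shows "u y \<ge> u x + \<gamma> * b" and "y \<notin> flat"
proof -
  show A: "u y \<ge> u x + \<gamma> * b"
    using x b y(2) unfolding flat_def by force
  show "y \<notin> flat"
  proof
    assume "y \<in> flat"
    then obtain r where r: "r > 0"
      and rr: "\<And>w p. w \<in> ball y r \<Longrightarrow> p \<in> cball w r \<Longrightarrow> p \<noteq> w \<Longrightarrow> u p < u w + \<gamma> * norm (p - w)"
      using flat_nhds by blast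
    have "\<gamma> * b > 0"
      using gamma_pos b(1) by simp
    then have yx: "y \<noteq> x"
      using A by auto
    define n where "n = norm (y - x)"
    have n: "n > 0" "n \<le> b"
      using yx y(1) by (auto simp: n_def dist_norm norm_minus_commute)
    define t where "t = min (1 / 2) (r / (2 * n))"
    have t: "0 < t" "t < 1" "t * n < r"
      using r n(1) by (auto simp: t_def min_def field_simps)
    define w where "w = y + t *\<^sub>R (x - y)"
    have wy: "norm (y - w) = t * n"
      using t(1) by (simp add: w_def n_def norm_minus_commute)
    have "w - x = (1 - t) *\<^sub>R (y - x)"
      by (simp add: w_def algebra_simps)
    then have wx: "norm (w - x) = (1 - t) * n"
      using t(2) by (simp add: n_def)
    have wb: "(1 - t) * n / b \<le> 1 - t"
      using n t b(1) by (simp add: divide_le_eq mult_left_mono)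
    have "(1 - t) * n \<le> 1 * b"
      using n t by (intro mult_mono) auto
    then have "w \<in> cball x b"
      using wx by (simp add: dist_norm norm_minus_commute)
    then have "u w \<le> u x + norm (w - x) / b * (u y - u x)"
      using y(2) by (intro inf_subharmonic_cone_above[OF sub open_dom b(2,1)]) auto
    also have "\<dots> \<le> u x + (1 - t) * (u y - u x)"
      using wb A \<open>\<gamma> * b > 0\<close> unfolding wx by (intro add_left_mono mult_right_mono) auto
    finally have "u w \<le> u y - t * (u y - u x)"
      by (simp add: algebra_simps)
    moreover have "t * (\<gamma> * b) \<le> t * (u y - u x)"
      using A t(1) by (intro mult_left_mono) auto
    moreover have "u y < u w + \<gamma> * (t * n)"
    proof -
      have "y \<noteq> w"
        using wy t(1) n(1) by auto
      then show ?thesis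
        using rr[of w y] wy t by (auto simp: dist_norm norm_minus_commute)
    qed
    moreover have "\<gamma> * (t * n) \<le> t * (\<gamma> * b)"
      using n(2) t(1) gamma_pos by simp
    ultimately show False
      by linarith
  qed
qed

end

text \<open>The point q has the smallest parameter at which the segment meets the closed complement
  of V. The half-open form of the conclusion is what estimates along segments of \<open>flat\<close>
  take as hypothesis.\<close>

lemma first_exit_point:
  fixes x y :: "'a::real_normed_vector"
  assumes "open V" "y \<notin> V"
  obtains q where "q \<in> closed_segment x y" "q \<notin> V"
    "x \<in> V \<Longrightarrow> \<forall>t\<in>{0..<1}. x + t *\<^sub>R (q - x) \<in> V" "x \<notin> V \<Longrightarrow> q = x"
proof -
  define \<sigma> where "\<sigma> = (\<lambda>t. x + t *\<^sub>R (y - x))"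
  have c: "continuous_on {0..1} \<sigma>"
    unfolding \<sigma>_def by (intro continuous_intros)
  define S where "S = {0..1} \<inter> \<sigma> -` (- V)"
  have "closed S"
    unfolding S_def using c assms(1) by (intro continuous_closed_preimage) auto
  then have "compact S"
    using bounded_closed_interval[of 0 "1::real"] bounded_subset[of "{0..1}" S]
    by (auto simp: compact_eq_bounded_closed S_def)
  moreover have "1 \<in> S"
    using assms(2) by (simp add: S_def \<sigma>_def)
  ultimately obtain T where T: "T \<in> S" "\<And>t. t \<in> S \<Longrightarrow> T \<le> t"
    using compact_attains_inf[of S] by auto
  show thesis
  proof (rule that[of "\<sigma> T"])
    show "\<sigma> T \<in> closed_segment x y"
      using T(1) by (auto simp: S_def \<sigma>_def in_segment algebra_simps intro!: exI[of _ T])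
    show "\<sigma> T \<notin> V"
      using T(1) by (simp add: S_def)
    show "\<sigma> T = x" if "x \<notin> V"
      using T(1) T(2)[of 0] that by (auto simp: S_def \<sigma>_def)
    assume "x \<in> V"
    then have "T \<noteq> 0"
      using \<open>\<sigma> T \<notin> V\<close> by (auto simp: \<sigma>_def)
    then have "T > 0" "T \<le> 1"
      using T(1) by (auto simp: S_def)
    show "\<forall>t\<in>{0..<1}. x + t *\<^sub>R (\<sigma> T - x) \<in> V"
    proof
      fix t :: real assume t: "t \<in> {0..<1}"
      then have "t * T < T"
        using \<open>T > 0\<close> by simp
      then have "t * T \<notin> S"
        using T(2) by fastforce
      then have "\<sigma> (t * T) \<in> V"
        using t \<open>T > 0\<close> \<open>T \<le> 1\<close> \<open>t * T < T\<close> by (auto simp: S_def)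
      then show "x + t *\<^sub>R (\<sigma> T - x) \<in> V"
        by (simp add: \<sigma>_def)
    qed
  qed
qed

lemma segment_end_in_closure:
  fixes p q :: "'a::real_normed_vector"
  assumes "\<forall>t\<in>{0..<1}. p + t *\<^sub>R (q - p) \<in> A"
  shows "q \<in> closure A"
proof -
  have "continuous_on (closure {0..<1}) (\<lambda>t. p + t *\<^sub>R (q - p))"
    by (intro continuous_intros)
  then have "(\<lambda>t. p + t *\<^sub>R (q - p)) ` closure {0..<1} \<subseteq> closure A"
    using assms closure_subset by (intro image_closure_subset) auto
  moreover have "q = p + 1 *\<^sub>R (q - p)"
    by simp
  ultimately show ?thesis
    by (auto simp: image_subset_iff dest!: bspec[of _ _ 1])
qed

section \<open>The eikonal replacement on the flat region\<close>

context slope_patch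
begin

text \<open>Since t = 0 is included, p is always flat, whereas q need not be. Inside
  \<open>flat\<close> segments can be reversed and F is locally Lipschitz; at an exit point q the
  condition only bounds F from below by u q minus \<gamma> times the length. The least such function
  is therefore the one of interest.\<close>

definition admissible :: "(real^'n \<Rightarrow> real) \<Rightarrow> bool" where
  "admissible F \<longleftrightarrow> (\<forall>x. x \<notin> flat \<longrightarrow> F x = u x) \<and>
     (\<forall>p q. (\<forall>t\<in>{0..<1}. p + t *\<^sub>R (q - p) \<in> flat) \<longrightarrow> F q \<le> F p + \<gamma> * norm (q - p))"

text \<open>On the flat region this is the solution of the eikonal equation with slope \<open>\<gamma>\<close> and boundary values u.\<close>
definition patch :: "real^'n \<Rightarrow> real" where
  "patch x = Inf {F x |F. admissible F}"

lemma admissible_self: "admissible u"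
  unfolding admissible_def using flat_segment_le(1) by auto

text \<open>As \<open>flat\<close> is bounded, a straight segment from x leaves it at some q, where
  F and u agree. Going out with F and back with u costs \<gamma> times the length of the segment
  each way, and the length is at most the diameter. This bounds the infimum from below and is the
  whole cost of patching.\<close>

lemma admissible_ge:
  assumes "admissible F"
  shows "u x - 2 * \<gamma> * diameter \<Omega> \<le> F x"
proof (cases "x \<in> flat")
  case False
  then show ?thesis
    using assms gamma_pos diameter_ge_0[OF bounded_dom] by (simp add: admissible_def)
next
  case True
  have "flat \<noteq> UNIV"
    using bounded_subset[OF bounded_dom flat_subset] not_bounded_UNIV by metis
  then obtain y where "y \<notin> flat"
    by auto
  then obtain q where q: "q \<notin> flat" and seg: "\<forall>t\<in>{0..<1}. x + t *\<^sub>R (q - x) \<in> flat"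
    using first_exit_point[OF open_flat, of y x] True by blast
  have "q \<in> closure \<Omega>" "x \<in> closure \<Omega>"
    using segment_end_in_closure[OF seg] closure_mono[OF flat_subset] True closure_subset by auto
  then have "norm (q - x) \<le> diameter \<Omega>"
    using diameter_bounded_bound[of "closure \<Omega>" q x] bounded_dom
    by (simp add: bounded_closure diameter_closure dist_norm)
  then have "\<gamma> * norm (q - x) \<le> \<gamma> * diameter \<Omega>"
    using gamma_pos by simp
  moreover have "u q \<le> F x + \<gamma> * norm (q - x)"
  proof -
    have "F q = u q" "F q \<le> F x + \<gamma> * norm (q - x)"
      using assms[unfolded admissible_def] q seg by blast+
    then show ?thesis
      by simp
  qed
  moreover have "u x \<le> u q + \<gamma> * norm (q - x)"
    using flat_segment_le(2) seg by auto
  ultimately show ?thesis by linarith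
qed

lemma patch_le_admissible:
  assumes "admissible F"
  shows "patch x \<le> F x"
proof -
  have "bdd_below {F x |F. admissible F}"
    using admissible_ge by (intro bdd_belowI[of _ "u x - 2 * \<gamma> * diameter \<Omega>"]) blast
  then show ?thesis
    unfolding patch_def using assms by (intro cInf_lower) auto
qed

lemma patch_le: "patch x \<le> u x"
  by (rule patch_le_admissible[OF admissible_self])

lemma patch_ge: "u x - 2 * \<gamma> * diameter \<Omega> \<le> patch x"
  unfolding patch_def using admissible_self admissible_ge by (intro cInf_greatest) auto

lemma patch_eq:
  assumes "x \<notin> flat"
  shows "patch x = u x"
proof -
  have "F x = u x" if "admissible F" for F
    using that assms by (simp add: admissible_def)
  then have "{F x |F. admissible F} = {u x}"
    using admissible_self by blast
  then show ?thesis
    by (simp add: patch_def)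
qed

lemma patch_segment:
  assumes "\<forall>t\<in>{0..<1}. p + t *\<^sub>R (q - p) \<in> flat"
  shows "patch q \<le> patch p + \<gamma> * norm (q - p)"
proof -
  have "patch q - \<gamma> * norm (q - p) \<le> F p" if F: "admissible F" for F
  proof -
    have "patch q \<le> F q"
      by (rule patch_le_admissible[OF F])
    also have "F q \<le> F p + \<gamma> * norm (q - p)"
      using F assms unfolding admissible_def by blast
    finally show ?thesis
      by simp
  qed
  then have "patch q - \<gamma> * norm (q - p) \<le> patch p"
    unfolding patch_def[of p] using admissible_self by (intro cInf_greatest) auto
  then show ?thesis
    by simp
qed

text \<open>Since \<open>patch \<le> u\<close>, a bound on \<open>patch\<close> does not bound u as
  such. But the maximum of u over a ball about a point outside \<open>flat\<close> is again attained
  outside \<open>flat\<close>, where both functions agree.\<close>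

lemma patch_steep_ball:
  assumes b: "cball z b \<subseteq> \<Omega>" and s: "\<forall>p\<in>cball z b. patch p \<le> s"
    and q: "q \<in> cball z b" "q \<notin> flat"
  shows "\<And>y. y \<in> cball q (b - norm (q - z)) \<Longrightarrow> u y \<le> s"
    and "patch q + \<gamma> * (b - norm (q - z)) \<le> s"
proof -
  define r where "r = b - norm (q - z)"
  have r0: "r \<ge> 0"
    using q(1) by (simp add: r_def dist_norm norm_minus_commute)
  have sb: "cball q r \<subseteq> cball z b"
  proof
    fix p assume "p \<in> cball q r"
    then show "p \<in> cball z b"
      using dist_triangle[of z p q] by (simp add: r_def dist_norm norm_minus_commute)
  qed
  have "(\<forall>y\<in>cball q r. u y \<le> s) \<and> patch q + \<gamma> * r \<le> s"
  proof (cases "r = 0")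
    case True
    then show ?thesis
      using bspec[OF s q(1)] q(2) by (simp add: patch_eq)
  next
    case False
    have sO: "cball q r \<subseteq> \<Omega>"
      using sb b by blast
    obtain m where m: "m \<in> cball q r" "\<And>y. y \<in> cball q r \<Longrightarrow> u y \<le> u m"
      using continuous_attains_sup[of "cball q r" u] continuous_on_subset[OF cont_dom sO] r0 by auto
    have "q \<in> \<Omega>" "r > 0"
      using q b r0 False by auto
    note st = steep_max_not_flat[OF \<open>q \<in> \<Omega>\<close> q(2) \<open>r > 0\<close> sO m]
    have "u m \<le> s"
      using bspec[OF s, of m] patch_eq[OF st(2)] m(1) sb by auto
    then show ?thesis
      using st(1) patch_eq[OF q(2)] order_trans[OF m(2)] by auto
  qed
  then show "\<And>y. y \<in> cball q (b - norm (q - z)) \<Longrightarrow> u y \<le> s"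
    and "patch q + \<gamma> * (b - norm (q - z)) \<le> s"
    by (auto simp: r_def)
qed

text \<open>Minimality is what forces the growth. The function G is the cone of slope \<gamma> about
  z that reaches s on the sphere; replacing \<open>patch\<close> by its minimum with G inside the
  ball keeps it admissible, because outside \<open>flat\<close> it already lies below G. Hence
  \<open>patch z \<le> G z\<close>, which is the claim.\<close>

lemma patch_increases:
  assumes b: "cball z b \<subseteq> \<Omega>" "b \<ge> 0" and s: "\<forall>p\<in>cball z b. patch p \<le> s"
  shows "patch z + \<gamma> * b \<le> s"
proof -
  define G where "G = (\<lambda>p. s - \<gamma> * (b - norm (p - z)))"
  define F where "F = (\<lambda>p. if p \<in> cball z b then min (patch p) (G p) else patch p)"
  have F_le: "F p \<le> patch p" for p
    by (simp add: F_def)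
  have "admissible F"
    unfolding admissible_def
  proof (intro conjI allI impI)
    fix x assume "x \<notin> flat"
    moreover from this have "patch x \<le> G x" if "x \<in> cball z b"
      using patch_steep_ball(2)[OF b(1) s that] by (simp add: G_def)
    ultimately show "F x = u x"
      by (simp add: F_def patch_eq min_def)
  next
    fix p q assume seg: "\<forall>t\<in>{0..<1}. p + t *\<^sub>R (q - p) \<in> flat"
    have *: "F q \<le> patch p + \<gamma> * norm (q - p)"
      using F_le[of q] patch_segment[OF seg] by linarith
    have "F q \<le> G p + \<gamma> * norm (q - p)" if p: "p \<in> cball z b"
    proof (cases "q \<in> cball z b")
      case True
      have "\<gamma> * norm (q - z) \<le> \<gamma> * norm (p - z) + \<gamma> * norm (q - p)"
        using gamma_pos norm_triangle_ineq[of "p - z" "q - p"] by (simp flip: distrib_left)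
      moreover have "F q \<le> G q"
        using True by (simp add: F_def)
      ultimately show ?thesis
        unfolding G_def right_diff_distrib by linarith
    next
      case False
      \<comment> \<open>A segment leaving the ball is cut where it crosses the sphere: there
        \<open>patch\<close> is at most s, and reaching the sphere from p takes a length of at least
        \<open>b - norm (p - z)\<close>, just what G subtracts from s.\<close>
      obtain c where c: "c \<in> closed_segment p q" "c \<in> sphere z b"
      proof -
        have "closed_segment p q \<inter> frontier (cball z b) \<noteq> {}"
          using connected_segment(1) p False by (intro connected_Int_frontier) auto
        then have "closed_segment p q \<inter> sphere z b \<noteq> {}"
          by simp
        then show ?thesis
          using that by blast
      qed
      then obtain t where t: "0 \<le> t" "t \<le> 1" "c = p + t *\<^sub>R (q - p)"
        by (auto simp: in_segment algebra_simps)
      have "t \<noteq> 1"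
        using c(2) t(3) False by auto
      have "c + t' *\<^sub>R (q - c) = p + (t + t' * (1 - t)) *\<^sub>R (q - p)" for t'
        unfolding t(3) by (simp add: algebra_simps)
      moreover have "t + t' * (1 - t) \<in> {0..<1}" if "t' \<in> {0..<1}" for t'
      proof -
        have "t' * (1 - t) < 1 * (1 - t)"
          using that t \<open>t \<noteq> 1\<close> by (intro mult_strict_right_mono) auto
        then show ?thesis
          using that t by auto
      qed
      ultimately have "\<forall>t'\<in>{0..<1}. c + t' *\<^sub>R (q - c) \<in> flat"
        using seg by metis
      then have "patch q \<le> patch c + \<gamma> * norm (q - c)"
        by (rule patch_segment)
      moreover have "patch c \<le> s"
        using s c(2) by auto
      moreover have "\<gamma> * norm (q - p) = \<gamma> * (norm (q - c) + norm (c - p))"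
      proof -
        have "q - c = (1 - t) *\<^sub>R (q - p)" "c - p = t *\<^sub>R (q - p)"
          unfolding t(3) by (simp_all add: algebra_simps)
        then have "norm (q - c) = (1 - t) * norm (q - p)" "norm (c - p) = t * norm (q - p)"
          using t(1,2) by simp_all
        then show ?thesis
          by (simp add: algebra_simps)
      qed
      moreover have "b \<le> norm (p - z) + norm (c - p)"
        using c(2) norm_triangle_ineq[of "p - z" "c - p"] by (simp add: dist_norm norm_minus_commute)
      then have "\<gamma> * b \<le> \<gamma> * (norm (p - z) + norm (c - p))"
        using gamma_pos by simp
      ultimately show ?thesis
        using F_le[of q] unfolding G_def right_diff_distrib distrib_left by linarith
    qed
    moreover have "F p = (if p \<in> cball z b then min (patch p) (G p) else patch p)"
      by (simp add: F_def)
    ultimately show "F q \<le> F p + \<gamma> * norm (q - p)"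
      using * by (auto simp: min_def)
  qed
  then have "patch z \<le> F z"
    by (rule patch_le_admissible)
  also have "\<dots> \<le> G z"
    using b(2) by (simp add: F_def)
  finally show ?thesis
    by (simp add: G_def)
qed

text \<open>As long as the segment from z stays in \<open>flat\<close>, the slope of
  \<open>patch\<close> is at most \<gamma>, which by \<open>patch_increases\<close> does not exceed
  the slope of the cone. From the first point q outside \<open>flat\<close> onwards, comparison with
  cones for u takes over on the ball about q, where u is bounded by s as well.\<close>

lemma patch_cone_above:
  assumes b: "cball z b \<subseteq> \<Omega>" "b > 0" and s: "\<forall>p\<in>cball z b. patch p \<le> s"
    and y: "norm (y - z) \<le> a" "a \<le> b"
  shows "patch y \<le> patch z + a / b * (s - patch z)"
proof -
  have inc: "\<gamma> * b \<le> s - patch z"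
    using patch_increases[OF b(1) _ s] b(2) by simp
  have pos: "s - patch z > 0"
    using inc mult_pos_pos[OF gamma_pos b(2)] by linarith
  have slope: "\<gamma> * r \<le> r / b * (s - patch z)" if "r \<ge> 0" for r
    using mult_left_mono[OF inc, of "r / b"] that b(2) by (simp add: field_simps)
  have yz: "y \<in> cball z b"
    using y by (simp add: dist_norm norm_minus_commute)
  have "patch y \<le> patch z + norm (y - z) / b * (s - patch z)"
  proof (cases "\<forall>t\<in>{0..<1}. z + t *\<^sub>R (y - z) \<in> flat")
    case True
    then show ?thesis
      using patch_segment[OF True] slope[of "norm (y - z)"] by simp
  next
    case False
    then obtain t where t: "t \<in> {0..<1}" "z + t *\<^sub>R (y - z) \<notin> flat"
      by blast
    define y' where "y' = z + t *\<^sub>R (y - z)"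
    obtain q where q: "q \<in> closed_segment z y'" "q \<notin> flat"
      and seg: "z \<in> flat \<Longrightarrow> \<forall>t\<in>{0..<1}. z + t *\<^sub>R (q - z) \<in> flat"
      and zq: "z \<notin> flat \<Longrightarrow> q = z"
      using first_exit_point[OF open_flat, of y' z] t(2) unfolding y'_def by blast
    obtain t' where t': "0 \<le> t'" "t' \<le> 1" "q = z + t' *\<^sub>R (y' - z)"
      using q(1) by (auto simp: in_segment algebra_simps)
    define l where "l = t' * t"
    have "l \<le> 1 * t"
      unfolding l_def using t(1) t' by (intro mult_right_mono) auto
    then have l: "0 \<le> l" "l < 1" "q = z + l *\<^sub>R (y - z)"
      using t(1) t' by (auto simp: l_def y'_def)
    define n where "n = norm (y - z)"
    have n: "n \<ge> 0" "n \<le> b"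
      using y by (auto simp: n_def)
    have qz: "norm (q - z) = l * n"
      using l by (simp add: n_def)
    have "y - q = (1 - l) *\<^sub>R (y - z)"
      using l(3) by (simp add: algebra_simps)
    then have yq: "norm (y - q) = (1 - l) * n"
      using l(2) by (simp add: n_def)
    have "l * n \<le> 1 * b"
      using n l by (intro mult_mono) auto
    then have qb: "q \<in> cball z b"
      using qz by (simp add: dist_norm norm_minus_commute)
    have "l * n \<le> l * b" "l * b < 1 * b"
      using n l b(2) by (auto intro: mult_left_mono)
    then have lnb: "l * n < b"
      by linarith
    define r where "r = b - l * n"
    have r: "r > 0"
      using lnb by (simp add: r_def)
    note st = patch_steep_ball[OF b(1) s qb q(2), unfolded qz, folded r_def]
    have rO: "cball q r \<subseteq> \<Omega>"
    proof
      fix p assume "p \<in> cball q r"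
      then have "p \<in> cball z b"
        using dist_triangle[of z p q] qz by (simp add: r_def dist_norm norm_minus_commute)
      then show "p \<in> \<Omega>" using b(1) by blast
    qed
    have "u y \<le> u q + norm (y - q) / r * (s - u q)"
    proof (rule inf_subharmonic_cone_above[OF sub open_dom rO r])
      show "u p \<le> u q + (s - u q)" if "p \<in> cball q r" for p
        using st(1)[OF that] by simp
      show "y \<in> cball q r"
        using yq n by (simp add: r_def dist_norm norm_minus_commute algebra_simps)
    qed
    then have "patch y \<le> patch q + (1 - l) * n / r * (s - patch q)"
      using patch_le[of y] patch_eq[OF q(2)] yq by simp
    also have "\<dots> = (1 - (1 - l) * n / r) * patch q + (1 - l) * n / r * s"
      unfolding right_diff_distrib left_diff_distrib by simp
    also have "\<dots> = (b - n) / r * patch q + (1 - l) * n / r * s"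
      using r by (simp add: r_def field_simps)
    also have "\<dots> \<le> (b - n) / r * (patch z + l * n / b * (s - patch z)) + (1 - l) * n / r * s"
    proof -
      have "patch q \<le> patch z + l * n / b * (s - patch z)"
      proof (cases "z \<in> flat")
        case True
        then show ?thesis
          using patch_segment[OF seg[OF True]] slope[OF mult_nonneg_nonneg[OF l(1) n(1)]]
          unfolding qz by linarith
      next
        case False
        then have "patch q = patch z"
          using zq by simp
        moreover have "0 \<le> l * n / b * (s - patch z)"
          using l(1) n(1) b(2) pos by simp
        ultimately show ?thesis
          by simp
      qed
      then show ?thesis
        using n r by (intro add_right_mono mult_left_mono) auto
    qed
    \<comment> \<open>Both estimates interpolate linearly along one ray and reach s at distance b
      from z, so they compose to a single cone.\<close>
    also have "\<dots> = patch z + n / b * (s - patch z)"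
    proof -
      have "(b - n) / r * (Z + l * n / b * (s - Z)) + (1 - l) * n / r * s = Z + n / b * (s - Z)" for Z
        using r b(2) by (simp add: r_def divide_simps) (simp add: algebra_simps)
      then show ?thesis .
    qed
    finally show ?thesis
      by (simp add: n_def)
  qed
  also have "\<dots> \<le> patch z + a / b * (s - patch z)"
    using y pos b(2) by (intro add_left_mono mult_right_mono divide_right_mono) auto
  finally show ?thesis .
qed

end

section \<open>Interpolation on conforming meshes\<close>

lemma barycentric_unique:
  fixes V :: "'a::real_vector set"
  assumes "finite V" "\<not> affine_dependent V"
    and "sum a V = sum b V" "(\<Sum>v\<in>V. a v *\<^sub>R v) = (\<Sum>v\<in>V. b v *\<^sub>R v)" and "v \<in> V"
  shows "a v = b v"
proof (rule ccontr)
  assume "a v \<noteq> b v"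
  then have "sum (\<lambda>v. a v - b v) V = 0 \<and> (\<exists>v\<in>V. a v - b v \<noteq> 0) \<and> (\<Sum>v\<in>V. (a v - b v) *\<^sub>R v) = 0"
    using assms(3-5) by (auto simp: sum_subtractf scaleR_left_diff_distrib)
  then show False
    using assms(1,2) affine_dependent_explicit_finite[of V] by meson
qed

text \<open>The choice in \<open>interp\<close> is harmless because of conformity: if x lies in two
  simplices it lies in the hull of their common vertices, and the coordinates with respect to these,
  extended by zero, are by affine independence the coordinates in either simplex.\<close>

lemma interp_eq:
  assumes T: "conforming_mesh \<T>" and V: "V \<in> \<T>"
    and a: "\<forall>v\<in>V. a v \<ge> 0" "sum a V = 1" "(\<Sum>v\<in>V. a v *\<^sub>R v) = x"
  shows "interp \<T> w x = (\<Sum>v\<in>V. a v * w v)"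
proof -
  have fin: "finite W" "\<not> affine_dependent W" if "W \<in> \<T>" for W
    using T that unfolding conforming_mesh_def is_simplex_vertices_def by auto
  have hull: "x \<in> convex hull W"
    if "W \<in> \<T>" "\<forall>v\<in>W. l v \<ge> 0" "sum l W = 1" "(\<Sum>v\<in>W. l v *\<^sub>R v) = x" for W l
    using that unfolding convex_hull_finite[OF fin(1)[OF that(1)]] by blast
  have key: "(\<Sum>v\<in>W. l v * w v) = (\<Sum>v\<in>V. a v * w v)"
    if W: "W \<in> \<T>" and l: "\<forall>v\<in>W. l v \<ge> 0" "sum l W = 1" "(\<Sum>v\<in>W. l v *\<^sub>R v) = x" for W l
  proof -
    have "x \<in> convex hull (V \<inter> W)"
      using hull[OF V a] hull[OF W l] T V W unfolding conforming_mesh_def by blast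
    then obtain j where j: "\<forall>v\<in>V \<inter> W. j v \<ge> 0" "sum j (V \<inter> W) = 1" "(\<Sum>v\<in>V \<inter> W. j v *\<^sub>R v) = x"
      using convex_hull_finite[of "V \<inter> W"] fin(1)[OF V] by auto
    define k where "k = (\<lambda>v. if v \<in> V \<inter> W then j v else 0)"
    have same: "(\<Sum>v\<in>Z. l v * w v) = (\<Sum>v\<in>V \<inter> W. j v * w v)"
      if Z: "Z \<in> \<T>" "V \<inter> W \<subseteq> Z" and l: "sum l Z = 1" "(\<Sum>v\<in>Z. l v *\<^sub>R v) = x" for Z l
    proof -
      have "sum k Z = sum j (V \<inter> W)"
        using Z fin(1)[OF Z(1)] by (intro sum.mono_neutral_cong_right) (auto simp: k_def)
      moreover have "(\<Sum>v\<in>Z. k v *\<^sub>R v) = (\<Sum>v\<in>V \<inter> W. j v *\<^sub>R v)"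
        using Z fin(1)[OF Z(1)] by (intro sum.mono_neutral_cong_right) (auto simp: k_def)
      ultimately have "l v = k v" if "v \<in> Z" for v
        using barycentric_unique[OF fin[OF Z(1)] _ _ that, of l k] l j by simp
      then have "(\<Sum>v\<in>Z. l v * w v) = (\<Sum>v\<in>Z. k v * w v)"
        by simp
      also have "\<dots> = (\<Sum>v\<in>V \<inter> W. j v * w v)"
        using Z fin(1)[OF Z(1)] by (intro sum.mono_neutral_cong_right) (auto simp: k_def)
      finally show ?thesis .
    qed
    show ?thesis
      using same[OF W _ l(2,3)] same[OF V _ a(2,3)] by simp
  qed
  define y0 where "y0 = (\<Sum>v\<in>V. a v * w v)"
  show ?thesis
    unfolding interp_def y0_def[symmetric]
  proof (rule some1_equality)
    show "\<exists>!y. \<exists>V\<in>\<T>. \<exists>l. (\<forall>v\<in>V. 0 \<le> l v) \<and> sum l V = 1 \<and> (\<Sum>v\<in>V. l v *\<^sub>R v) = x \<and> y = (\<Sum>v\<in>V. l v * w v)"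
      using key V a unfolding y0_def by (intro ex1I[of _ "\<Sum>v\<in>V. a v * w v"]) blast+
    show "\<exists>V\<in>\<T>. \<exists>l. (\<forall>v\<in>V. 0 \<le> l v) \<and> sum l V = 1 \<and> (\<Sum>v\<in>V. l v *\<^sub>R v) = x \<and>
        y0 = (\<Sum>v\<in>V. l v * w v)"
      using V a unfolding y0_def by blast
  qed
qed

lemma dist_vertex_le_mesh_size:
  assumes T: "conforming_mesh \<T>" and "V \<in> \<T>" "v \<in> V" "x \<in> convex hull V"
  shows "dist x v \<le> mesh_size \<T>"
proof -
  have "finite \<T>" "finite V"
    using T assms(2) unfolding conforming_mesh_def is_simplex_vertices_def by auto
  then have "dist x v \<le> diameter (convex hull V)"
    using assms(3,4) hull_inc[of v V convex]
    by (intro diameter_bounded_bound) (auto intro: bounded_convex_hull finite_imp_bounded)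
  also have "\<dots> \<le> mesh_size \<T>"
    unfolding mesh_size_def using \<open>finite \<T>\<close> assms(2) by (intro Max_ge) auto
  finally show ?thesis .
qed

text \<open>The vertices and weights are chosen before w, so one combination serves several nodal
  functions at once; monotonicity, oddness and convexity estimates all rest on this.\<close>

lemma interp_convex_combination:
  assumes T: "conforming_mesh \<T>" and x: "x \<in> (\<Union>V\<in>\<T>. convex hull V)"
  shows "\<exists>V l. finite V \<and> V \<subseteq> mesh_nodes \<T> \<and> (\<forall>v\<in>V. dist x v \<le> mesh_size \<T>) \<and>
    (\<forall>v\<in>V. l v \<ge> 0) \<and> sum l V = 1 \<and> (\<forall>w. interp \<T> w x = (\<Sum>v\<in>V. l v * w v))"
proof -
  obtain V where V: "V \<in> \<T>" "x \<in> convex hull V"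
    using x by blast
  have fin: "finite V"
    using T V(1) unfolding conforming_mesh_def is_simplex_vertices_def by blast
  obtain l where l: "\<forall>v\<in>V. l v \<ge> 0" "sum l V = 1" "(\<Sum>v\<in>V. l v *\<^sub>R v) = x"
    using V(2) unfolding convex_hull_finite[OF fin] by auto
  show ?thesis
  proof (intro exI[of _ V] exI[of _ l] conjI ballI allI)
    show "V \<subseteq> mesh_nodes \<T>"
      using V(1) by (auto simp: mesh_nodes_def)
    show "dist x v \<le> mesh_size \<T>" if "v \<in> V" for v
      by (rule dist_vertex_le_mesh_size[OF T V(1) that V(2)])
    show "interp \<T> w x = (\<Sum>v\<in>V. l v * w v)" for w
      by (rule interp_eq[OF T V(1) l])
  qed (use fin l in auto)
qed

lemma interp_node:
  assumes T: "conforming_mesh \<T>" and z: "z \<in> mesh_nodes \<T>"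
  shows "interp \<T> w z = w z"
proof -
  obtain V where V: "V \<in> \<T>" "z \<in> V"
    using z by (auto simp: mesh_nodes_def)
  have fin: "finite V"
    using T V(1) unfolding conforming_mesh_def is_simplex_vertices_def by blast
  have "interp \<T> w z = (\<Sum>v\<in>V. (if v = z then 1 else 0) * w v)"
    using V fin by (intro interp_eq[OF T])
      (auto simp: if_distrib[of "\<lambda>c. c *\<^sub>R _"] sum.delta cong: if_cong)
  also have "\<dots> = w z"
    using V fin by (simp add: if_distrib[of "\<lambda>c. c * _"] sum.delta cong: if_cong)
  finally show ?thesis .
qed

lemma interp_uminus:
  assumes "conforming_mesh \<T>" "x \<in> (\<Union>V\<in>\<T>. convex hull V)"
  shows "interp \<T> (\<lambda>y. - w y) x = - interp \<T> w x"
proof -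
  obtain V l where "finite V" "V \<subseteq> mesh_nodes \<T>" "\<forall>v\<in>V. dist x v \<le> mesh_size \<T>"
    "\<forall>v\<in>V. l v \<ge> 0" "sum l V = 1" "\<forall>w. interp \<T> w x = (\<Sum>v\<in>V. l v * w v)"
    using interp_convex_combination[OF assms] by (elim exE conjE) (rule that; assumption)
  then show ?thesis
    by (simp add: sum_negf)
qed

lemma interp_ge:
  assumes "conforming_mesh \<T>" "x \<in> (\<Union>V\<in>\<T>. convex hull V)"
    and "\<And>v. v \<in> mesh_nodes \<T> \<Longrightarrow> dist x v \<le> mesh_size \<T> \<Longrightarrow> c \<le> w v"
  shows "c \<le> interp \<T> w x"
proof -
  obtain V l where V: "finite V" "V \<subseteq> mesh_nodes \<T>" "\<forall>v\<in>V. dist x v \<le> mesh_size \<T>"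
    "\<forall>v\<in>V. l v \<ge> 0" "sum l V = 1" "\<forall>w. interp \<T> w x = (\<Sum>v\<in>V. l v * w v)"
    using interp_convex_combination[OF assms(1,2)] by (elim exE conjE) (rule that; assumption)
  have "c = (\<Sum>v\<in>V. l v * c)"
    using V(5) by (simp flip: sum_distrib_right)
  also have "\<dots> \<le> (\<Sum>v\<in>V. l v * w v)"
    using V assms(3) by (intro sum_mono mult_left_mono) auto
  finally show ?thesis
    using V(6) by simp
qed

lemma interp_mono:
  assumes "conforming_mesh \<T>" "x \<in> (\<Union>V\<in>\<T>. convex hull V)"
    and "\<And>v. v \<in> mesh_nodes \<T> \<Longrightarrow> w1 v \<le> w2 v + c"
  shows "interp \<T> w1 x \<le> interp \<T> w2 x + c"
proof -
  obtain V l where V: "finite V" "V \<subseteq> mesh_nodes \<T>" "\<forall>v\<in>V. dist x v \<le> mesh_size \<T>"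
    "\<forall>v\<in>V. l v \<ge> 0" "sum l V = 1" "\<forall>w. interp \<T> w x = (\<Sum>v\<in>V. l v * w v)"
    using interp_convex_combination[OF assms(1,2)] by (elim exE conjE) (rule that; assumption)
  have "(\<Sum>v\<in>V. l v * w1 v) \<le> (\<Sum>v\<in>V. l v * (w2 v + c))"
    using V assms(3) by (intro sum_mono mult_left_mono) auto
  also have "\<dots> = (\<Sum>v\<in>V. l v * w2 v) + c"
    using V(5) by (simp add: distrib_left sum.distrib flip: sum_distrib_right)
  finally show ?thesis
    using V(6) by simp
qed

text \<open>Jensen's inequality for the convex function t + c t^2, obtained from the tangent of the
  square at the interpolated value.\<close>

lemma interp_quadratic_ge:
  assumes "conforming_mesh \<T>" "x \<in> (\<Union>V\<in>\<T>. convex hull V)" "c \<ge> 0"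
  shows "interp \<T> w x + c * (interp \<T> w x)\<^sup>2 \<le> interp \<T> (\<lambda>y. w y + c * (w y)\<^sup>2) x"
proof -
  obtain V l where V: "finite V" "V \<subseteq> mesh_nodes \<T>" "\<forall>v\<in>V. dist x v \<le> mesh_size \<T>"
    "\<forall>v\<in>V. l v \<ge> 0" "sum l V = 1" "\<forall>w. interp \<T> w x = (\<Sum>v\<in>V. l v * w v)"
    using interp_convex_combination[OF assms(1,2)] by (elim exE conjE) (rule that; assumption)
  define X where "X = interp \<T> w x"
  have X: "(\<Sum>v\<in>V. l v * w v) = X"
    using V(6) by (simp add: X_def)
  have "X\<^sup>2 = 2 * X * (\<Sum>v\<in>V. l v * w v) - X\<^sup>2 * sum l V"
    using X V(5) by (simp add: power2_eq_square)
  also have "\<dots> = (\<Sum>v\<in>V. l v * (2 * X * w v - X\<^sup>2))"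
    by (simp add: right_diff_distrib sum_subtractf sum_distrib_left sum_distrib_right mult_ac)
  also have "\<dots> \<le> (\<Sum>v\<in>V. l v * (w v)\<^sup>2)"
  proof (intro sum_mono mult_left_mono)
    fix v assume "v \<in> V"
    have "0 \<le> (w v - X)\<^sup>2"
      by simp
    then show "2 * X * w v - X\<^sup>2 \<le> (w v)\<^sup>2"
      by (simp add: power2_diff mult_ac)
  qed (use V in auto)
  finally have "c * X\<^sup>2 \<le> c * (\<Sum>v\<in>V. l v * (w v)\<^sup>2)"
    using assms(3) by (rule mult_left_mono)
  then have "X + c * X\<^sup>2 \<le> (\<Sum>v\<in>V. l v * w v) + c * (\<Sum>v\<in>V. l v * (w v)\<^sup>2)"
    using X by simp
  also have "\<dots> = (\<Sum>v\<in>V. l v * (w v + c * (w v)\<^sup>2))"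
    by (simp add: distrib_left sum.distrib sum_distrib_left mult_ac)
  finally show ?thesis
    using V(6) by (simp add: X_def)
qed

text \<open>The mesh domain is an interior, so nodes may lie on its boundary; each simplex is
  nondegenerate and hence contained in the closure of its own interior.\<close>

lemma mesh_nodes_in_closure:
  assumes T: "conforming_mesh \<T>"
  shows "mesh_nodes \<T> \<subseteq> closure (mesh_domain \<T>)"
proof
  fix z assume "z \<in> mesh_nodes \<T>"
  then obtain V where V: "V \<in> \<T>" "z \<in> V"
    by (auto simp: mesh_nodes_def)
  have V_simplex: "card V = CARD('a) + 1" "\<not> affine_dependent V"
    using T V(1) unfolding conforming_mesh_def is_simplex_vertices_def by auto
  have "interior (convex hull V) \<noteq> {}"
    using V_simplex interior_convex_hull_eq_empty[of V] by simp
  then have "closure (interior (convex hull V)) = closure (convex hull V)"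
    by (intro convex_closure_interior convex_convex_hull)
  moreover have "z \<in> closure (convex hull V)"
    using hull_inc[OF V(2)] closure_subset by blast
  moreover have "interior (convex hull V) \<subseteq> mesh_domain \<T>"
    unfolding mesh_domain_def using V(1) by (intro interior_mono) blast
  ultimately show "z \<in> closure (mesh_domain \<T>)"
    using closure_mono[of "interior (convex hull V)" "mesh_domain \<T>"] by auto
qed

section \<open>Discrete comparison principle\<close>

lemma Max_Min_image_le_add:
  fixes f g :: "'a \<Rightarrow> real"
  assumes "finite A" "A \<noteq> {}" "\<And>x. x \<in> A \<Longrightarrow> f x \<le> g x + c"
  shows "Max (f ` A) \<le> Max (g ` A) + c" and "Min (f ` A) \<le> Min (g ` A) + c"
proof -
  show "Max (f ` A) \<le> Max (g ` A) + c"
  proof (rule Max.boundedI)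
    fix y assume "y \<in> f ` A"
    then obtain x where x: "x \<in> A" "y = f x" by blast
    then have "g x \<le> Max (g ` A)"
      using assms(1) by (intro Max_ge) auto
    then show "y \<le> Max (g ` A) + c"
      using assms(3)[OF x(1)] x(2) by linarith
  qed (use assms in auto)
  have "Min (g ` A) \<in> g ` A"
    using assms by (intro Min_in) auto
  then obtain x where x: "x \<in> A" "Min (g ` A) = g x" by blast
  then have "Min (f ` A) \<le> f x"
    using assms(1) by (intro Min_le) auto
  then show "Min (f ` A) \<le> Min (g ` A) + c"
    using assms(3)[OF x(1)] x(2) by linarith
qed

text \<open>At a node y maximizing W - U, interpolation, maximum and minimum are monotone and
  respect added constants, so the strict inequality for W would make \<open>2 * U y\<close> smaller
  than the right-hand side of its own equation. Thus y is not in I, and the bound at y propagates to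
  all nodes.\<close>

lemma discrete_comparison:
  assumes T: "conforming_mesh \<T>" and S: "finite S"
    and I: "\<And>z. z \<in> I \<Longrightarrow> stencil \<epsilon> S z \<subseteq> (\<Union>V\<in>\<T>. convex hull V)"
    and W: "\<And>z. z \<in> I \<Longrightarrow>
      2 * W z < Max (interp \<T> W ` stencil \<epsilon> S z) + Min (interp \<T> W ` stencil \<epsilon> S z)"
    and U: "\<And>z. z \<in> I \<Longrightarrow>
      2 * U z = Max (interp \<T> U ` stencil \<epsilon> S z) + Min (interp \<T> U ` stencil \<epsilon> S z)"
    and bdry: "\<And>z. z \<in> mesh_nodes \<T> - I \<Longrightarrow> W z \<le> U z + m"
    and z: "z \<in> mesh_nodes \<T>"
  shows "W z \<le> U z + m"
proof -
  have "finite (mesh_nodes \<T>)"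
    using T unfolding conforming_mesh_def is_simplex_vertices_def mesh_nodes_def by auto
  then obtain y where y: "y \<in> mesh_nodes \<T>" "\<And>x. x \<in> mesh_nodes \<T> \<Longrightarrow> W x - U x \<le> W y - U y"
    using continuous_attains_sup[of "mesh_nodes \<T>" "\<lambda>x. W x - U x"] z
    by (auto simp: finite_imp_compact continuous_on_finite)
  have "y \<notin> I"
  proof
    assume yI: "y \<in> I"
    have fin: "finite (stencil \<epsilon> S y)" "stencil \<epsilon> S y \<noteq> {}"
      using S by (auto simp: stencil_def)
    have "interp \<T> W x \<le> interp \<T> U x + (W y - U y)" if "x \<in> stencil \<epsilon> S y" for x
    proof (rule interp_mono[OF T])
      show "x \<in> (\<Union>V\<in>\<T>. convex hull V)"
        using I[OF yI] that by blast
      show "W v \<le> U v + (W y - U y)" if "v \<in> mesh_nodes \<T>" for v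
        using y(2)[OF that] by simp
    qed
    note le = Max_Min_image_le_add[OF fin, of "interp \<T> W" "interp \<T> U" "W y - U y", OF this]
    show False
      using le W[OF yI] U[OF yI] by linarith
  qed
  then have "W y \<le> U y + m"
    using bdry y(1) by blast
  then show ?thesis
    using y(2)[OF z] by linarith
qed

section \<open>The error estimate\<close>

lemma cball_subset_of_infdist_frontier:
  fixes \<Omega> :: "'a::real_normed_vector set"
  assumes "z \<in> \<Omega>" "infdist z (frontier \<Omega>) > r" "r \<ge> 0"
  shows "cball z r \<subseteq> \<Omega>"
proof (rule ccontr)
  assume "\<not> cball z r \<subseteq> \<Omega>"
  moreover have "z \<in> cball z r"
    using assms(3) by simp
  ultimately have "cball z r \<inter> frontier \<Omega> \<noteq> {}"
    using assms(1) by (intro connected_Int_frontier convex_connected convex_cball) blast+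
  then obtain y where "y \<in> frontier \<Omega>" "dist z y \<le> r"
    by auto
  then show False
    using infdist_le[of y "frontier \<Omega>" z] assms(2) by linarith
qed

text \<open>A stencil point moves by at most \<epsilon> and so keeps a distance greater than
  \<epsilon> \<ge> h from the frontier.\<close>

lemma stencil_subset_mesh:
  assumes inner: "inner_set \<Omega> (mesh_size \<T>) \<subseteq> mesh_domain \<T>"
    and h: "mesh_size \<T> \<le> \<epsilon>" "\<epsilon> > 0" and S: "S \<subseteq> sphere 0 1" and z: "z \<in> inner_set \<Omega> (2 * \<epsilon>)"
  shows "stencil \<epsilon> S z \<subseteq> (\<Union>V\<in>\<T>. convex hull V)"
proof
  fix x assume x: "x \<in> stencil \<epsilon> S z"
  have zO: "z \<in> \<Omega>" "infdist z (frontier \<Omega>) > 2 * \<epsilon>"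
    using z by (auto simp: inner_set_def)
  have d: "dist z x \<le> \<epsilon>"
    using x S h(2) by (auto simp: stencil_def dist_norm)
  then have "x \<in> \<Omega>"
    using cball_subset_of_infdist_frontier[OF zO] h(2) by auto
  moreover have "infdist x (frontier \<Omega>) > mesh_size \<T>"
    using infdist_triangle[of z "frontier \<Omega>" x] d zO(2) h by linarith
  ultimately have "x \<in> mesh_domain \<T>"
    using inner by (auto simp: inner_set_def)
  then show "x \<in> (\<Union>V\<in>\<T>. convex hull V)"
    unfolding mesh_domain_def using interior_subset by blast
qed

text \<open>The second-order gain of the convex function \<open>t + c * t\<^sup>2\<close> absorbs the excess of the weight \<open>l\<close>
over one half.\<close>
lemma quadratic_correction_gain:
  fixes t :: real
  assumes "\<bar>t\<bar> \<le> N" "2 * c * N \<le> 1" "c > 0" "b > 0" "1 / 2 \<le> l" "l \<le> 3 / 5" "8 * (2 * l - 1) < c * b"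
  shows "2 * (t + l * b + c * (t + l * b)\<^sup>2) < (t + b + c * (t + b)\<^sup>2) + (t + c * t\<^sup>2)"
proof -
  have "2 * c * t \<le> 2 * c * N"
    using assms(1,3) by (intro mult_left_mono) auto
  then have "(2 * l - 1) * (1 + 2 * c * t) \<le> (2 * l - 1) * 2"
    using assms(2,5) by (intro mult_left_mono) auto
  also have "\<dots> < c * b * (1 / 4)"
    using assms(7) by simp
  \<comment> \<open>From l \<le> 3/5 follows 1 - 2 l^2 \<ge> 7/25 > 1/4. This 1/4, together with the
    bound 2 on \<open>1 + 2 * c * t\<close>, accounts for the 8 in the hypothesis.\<close>
  also have "\<dots> \<le> c * b * (1 - 2 * l\<^sup>2)"
  proof -
    have "l\<^sup>2 \<le> (3 / 5)\<^sup>2"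
      using assms(5,6) by (intro power_mono) auto
    then show ?thesis
      using assms(3,4) by (intro mult_left_mono) (auto simp: power2_eq_square)
  qed
  finally have "0 < b * (c * b * (1 - 2 * l\<^sup>2) - (2 * l - 1) * (1 + 2 * c * t))"
    using assms(4) by simp
  then show ?thesis
    by (simp add: power2_eq_square algebra_simps)
qed

text \<open>The difference factors as (s - t)(1 + c (s + t)), and the smallness of c N keeps the
  second factor nonnegative.\<close>

lemma quadratic_correction_mono:
  fixes s t :: real
  assumes "t \<le> s" "\<bar>t\<bar> \<le> N" "\<bar>s\<bar> \<le> N" "2 * c * N \<le> 1" "c \<ge> 0"
  shows "t + c * t\<^sup>2 \<le> s + c * s\<^sup>2"
proof -
  have "c * (- (s + t)) \<le> c * (2 * N)"
    using assms by (intro mult_left_mono) auto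
  then have "0 \<le> (s - t) * (1 + c * (s + t))"
    using assms by (intro mult_nonneg_nonneg) (auto simp: algebra_simps)
  then show ?thesis
    by (simp add: power2_eq_square algebra_simps)
qed

section \<open>The discrete subsolution and the estimate at the nodes\<close>

context slope_patch
begin

text \<open>The ball is cut off at \<open>closure \<Omega>\<close>, where \<open>patch\<close> is
  bounded, because boundary nodes may be closer to the frontier than a.\<close>

definition patch_sup :: "real \<Rightarrow> real^'n \<Rightarrow> real" where
  "patch_sup a x = Sup (patch ` (cball x a \<inter> closure \<Omega>))"

lemma patch_sup_ge:
  assumes "\<forall>y\<in>closure \<Omega>. \<bar>patch y\<bar> \<le> N" "p \<in> closure \<Omega>" "dist x p \<le> a"
  shows "patch p \<le> patch_sup a x"
  unfolding patch_sup_def using assms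
  by (intro cSUP_upper bdd_aboveI[of _ N]) (auto simp: abs_le_iff)

lemma patch_sup_le:
  assumes "x \<in> closure \<Omega>" "a \<ge> 0" "\<And>p. p \<in> closure \<Omega> \<Longrightarrow> dist x p \<le> a \<Longrightarrow> patch p \<le> s"
  shows "patch_sup a x \<le> s"
proof -
  have "x \<in> cball x a"
    using assms(2) by simp
  then have "cball x a \<inter> closure \<Omega> \<noteq> {}"
    using assms(1) by blast
  then show ?thesis
    unfolding patch_sup_def using assms(3) by (intro cSUP_least) auto
qed

text \<open>Maxima over radius a = \<epsilon> + h absorb both discretizations: the nodes used at a
  stencil point are within h of it, and each p in the ball of radius b = 2\<epsilon> -
  \<epsilon>\<theta> is within \<epsilon> of some stencil point. So the largest interpolated value X
  bounds \<open>patch\<close> on that ball, and cones between the radii a and b give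
  \<open>w z\<close> at most t0 + l (X - t0) with l = a/b. All relevant nodes see z, so the minimum
  over the stencil is controlled by t0 = \<open>patch z\<close>.\<close>

lemma patch_sup_strict_subsolution:
  assumes T: "conforming_mesh \<T>" and inner: "inner_set \<Omega> (mesh_size \<T>) \<subseteq> mesh_domain \<T>"
    and sub_dom: "mesh_domain \<T> \<subseteq> \<Omega>"
    and h: "0 \<le> mesh_size \<T>" "mesh_size \<T> \<le> \<epsilon>" "\<epsilon> > 0" and th: "0 \<le> \<theta>" "\<theta> \<le> 1"
    and S: "direction_set \<theta> S"
    and N: "\<forall>y\<in>closure \<Omega>. \<bar>patch y\<bar> \<le> N" "2 * \<gamma> * N \<le> 1"
    and r1: "5 * (\<epsilon> + mesh_size \<T>) \<le> 3 * (2 * \<epsilon> - \<epsilon> * \<theta>)"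
    and r2: "8 * (2 * mesh_size \<T> + \<epsilon> * \<theta>) < \<gamma>\<^sup>2 * (2 * \<epsilon> - \<epsilon> * \<theta>)\<^sup>2"
    and z: "z \<in> interior_nodes \<Omega> \<T> \<epsilon>"
  defines "w \<equiv> patch_sup (\<epsilon> + mesh_size \<T>)"
  defines "W \<equiv> \<lambda>x. w x + \<gamma> * (w x)\<^sup>2"
  shows "2 * W z < Max (interp \<T> W ` stencil \<epsilon> S z) + Min (interp \<T> W ` stencil \<epsilon> S z)"
proof -
  define a where "a = \<epsilon> + mesh_size \<T>"
  define b where "b = 2 * \<epsilon> - \<epsilon> * \<theta>"
  have et: "0 \<le> \<epsilon> * \<theta>" "\<epsilon> * \<theta> \<le> \<epsilon>"
    using h th mult_left_mono[of \<theta> 1 \<epsilon>] by auto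
  have ab: "0 < a" "0 < b" "a \<le> b" "b \<le> 2 * \<epsilon>" "\<epsilon> \<le> a"
    using et h r1 by (auto simp: a_def b_def)
  have zn: "z \<in> mesh_nodes \<T>" and zi: "z \<in> inner_set \<Omega> (2 * \<epsilon>)"
    using z by (auto simp: interior_nodes_def)
  have b2: "cball z (2 * \<epsilon>) \<subseteq> \<Omega>"
    using zi h by (intro cball_subset_of_infdist_frontier) (auto simp: inner_set_def)
  have bO: "cball z b \<subseteq> \<Omega>"
    using b2 ab(4) by auto
  have zcl: "z \<in> closure \<Omega>"
    using bO ab(2) closure_subset by fastforce
  have Ssub: "S \<subseteq> sphere 0 1" and Sfin: "finite S"
    using S by (auto simp: direction_set_def)
  have st: "stencil \<epsilon> S z \<subseteq> (\<Union>V\<in>\<T>. convex hull V)"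
    by (rule stencil_subset_mesh[OF inner h(2,3) Ssub zi])
  have st_fin: "finite (stencil \<epsilon> S z)" "stencil \<epsilon> S z \<noteq> {}"
    using Sfin by (auto simp: stencil_def)
  have nodes_cl: "v \<in> closure \<Omega>" if "v \<in> mesh_nodes \<T>" for v
    using mesh_nodes_in_closure[OF T] closure_mono[OF sub_dom] that by blast
  have wN: "\<bar>w v\<bar> \<le> N" if "v \<in> mesh_nodes \<T>" for v
  proof -
    have "patch v \<le> w v"
      unfolding w_def using patch_sup_ge[OF N(1) nodes_cl[OF that]] h by simp
    moreover have "w v \<le> N"
      unfolding w_def using N(1) nodes_cl[OF that] h by (intro patch_sup_le) (auto simp: abs_le_iff)
    ultimately show ?thesis
      using N(1) nodes_cl[OF that] by (force simp: abs_le_iff)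
  qed
  define X where "X = Max (interp \<T> w ` stencil \<epsilon> S z)"
  have X_ge: "interp \<T> w x \<le> X" if "x \<in> stencil \<epsilon> S z" for x
    unfolding X_def using st_fin that by (intro Max_ge) auto
  have patch_X: "patch p \<le> X" if p: "p \<in> cball z b" for p
  proof -
    have pcl: "p \<in> closure \<Omega>"
      using p bO closure_subset by blast
    define t where "t = norm (p - z)"
    have t: "t \<le> b"
      using p by (simp add: t_def dist_norm norm_minus_commute)
    \<comment> \<open>Within \<epsilon>\<theta> of z the centre of the stencil suffices. Otherwise a
      direction v near e gives distance at most |t - \<epsilon>| + \<epsilon>\<theta>, which is at
      most \<epsilon> exactly for \<epsilon>\<theta> \<le> t \<le> b; this fixes b.\<close>
    show ?thesis
    proof (cases "t \<le> \<epsilon> * \<theta>")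
      case True
      then have "patch p \<le> w z"
        unfolding w_def using et(2) h(1) t_def
        by (intro patch_sup_ge[OF N(1) pcl]) (simp add: dist_norm norm_minus_commute)
      also have "w z = interp \<T> w z"
        using interp_node[OF T zn] by simp
      also have "\<dots> \<le> X"
        by (rule X_ge) (simp add: stencil_def)
      finally show ?thesis .
    next
      case False
      then have tpos: "t > 0"
        using et by linarith
      define e where "e = (1 / t) *\<^sub>R (p - z)"
      have "e \<in> sphere 0 1"
        using tpos by (simp add: e_def t_def)
      then obtain v where v: "v \<in> S" "norm (e - v) \<le> \<theta>"
        using S unfolding direction_set_def by blast
      have "norm v = 1"
        using v(1) Ssub by auto
      have pe: "p = z + t *\<^sub>R e"
        using tpos by (simp add: e_def)
      have "norm (p - (z + \<epsilon> *\<^sub>R v)) = norm ((t - \<epsilon>) *\<^sub>R e + \<epsilon> *\<^sub>R (e - v))"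
        unfolding pe by (simp add: algebra_simps)
      also have "\<dots> \<le> \<bar>t - \<epsilon>\<bar> * norm e + \<epsilon> * norm (e - v)"
        using norm_triangle_ineq[of "(t - \<epsilon>) *\<^sub>R e" "\<epsilon> *\<^sub>R (e - v)"] h(3) by simp
      also have "\<dots> \<le> \<bar>t - \<epsilon>\<bar> + \<epsilon> * \<theta>"
        using \<open>e \<in> sphere 0 1\<close> v(2) h(3) by simp
      also have "\<dots> \<le> \<epsilon>"
        using False t et by (auto simp: b_def abs_if)
      finally have close: "dist (z + \<epsilon> *\<^sub>R v) p \<le> \<epsilon>"
        by (simp add: dist_norm norm_minus_commute)
      have vst: "z + \<epsilon> *\<^sub>R v \<in> stencil \<epsilon> S z"
        using v(1) unfolding stencil_def by blast
      have "patch p \<le> interp \<T> w (z + \<epsilon> *\<^sub>R v)"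
      proof (rule interp_ge[OF T])
        show "z + \<epsilon> *\<^sub>R v \<in> (\<Union>V\<in>\<T>. convex hull V)"
          using st vst by blast
        show "patch p \<le> w y" if "dist (z + \<epsilon> *\<^sub>R v) y \<le> mesh_size \<T>" for y
          unfolding w_def using that close dist_triangle3[of y p "z + \<epsilon> *\<^sub>R v"]
          by (intro patch_sup_ge[OF N(1) pcl]) linarith
      qed
      also have "\<dots> \<le> X"
        by (rule X_ge[OF vst])
      finally show ?thesis .
    qed
  qed
  have patch_Xb: "\<forall>p\<in>cball z b. patch p \<le> X"
    using patch_X by blast
  define t0 where "t0 = patch z"
  have t0N: "\<bar>t0\<bar> \<le> N"
    using N(1) zcl by (simp add: t0_def)
  have inc: "t0 + \<gamma> * b \<le> X"
    unfolding t0_def using patch_increases[OF bO _ patch_Xb] ab by simp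
  have gb: "\<gamma> * b > 0"
    using gamma_pos ab by simp
  have XN: "\<bar>X\<bar> \<le> N"
  proof -
    have "X \<in> interp \<T> w ` stencil \<epsilon> S z"
      unfolding X_def using st_fin by (intro Max_in) auto
    then obtain x where x: "x \<in> stencil \<epsilon> S z" "X = interp \<T> w x" by blast
    then have "interp \<T> (\<lambda>y. - w y) x = - X"
      using st by (auto intro!: interp_uminus[OF T])
    moreover have "- N \<le> interp \<T> (\<lambda>y. - w y) x"
      using st x(1) wN by (intro interp_ge[OF T]) (auto simp: abs_le_iff)
    ultimately show ?thesis
      using inc gb t0N by linarith
  qed
  define l where "l = a / b"
  have wz: "w z \<le> t0 + l * (X - t0)"
    unfolding w_def
  proof (rule patch_sup_le[OF zcl])
    show "patch p \<le> t0 + l * (X - t0)" if "dist z p \<le> \<epsilon> + mesh_size \<T>" for p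
      unfolding t0_def l_def using that patch_Xb ab a_def
      by (intro patch_cone_above[OF bO]) (auto simp: dist_norm norm_minus_commute)
  qed (use h in auto)
  have l: "1 / 2 \<le> l" "l \<le> 3 / 5"
    using ab et h r1 by (auto simp: l_def a_def b_def field_simps)
  \<comment> \<open>The excess is 2l - 1 = (2h + \<epsilon>\<theta>)/b. Of the two factors \<gamma>
    that beat it, one is the coefficient of the square, the other the slope floor in X - t0 \<ge>
    \<gamma> b.\<close>
  have gain: "8 * (2 * l - 1) < \<gamma> * (X - t0)"
  proof -
    have "8 * (2 * l - 1) * b = 8 * (2 * mesh_size \<T> + \<epsilon> * \<theta>)"
    proof -
      have "l * b = a"
        using ab(2) by (simp add: l_def)
      then have "8 * (2 * l - 1) * b = 16 * a - 8 * b"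
        by (simp add: algebra_simps)
      then show ?thesis
        by (simp add: a_def b_def)
    qed
    also have "\<dots> < \<gamma> * (\<gamma> * b) * b"
      using r2 by (simp add: b_def power2_eq_square mult_ac)
    finally have "8 * (2 * l - 1) < \<gamma> * (\<gamma> * b)"
      using ab(2) by simp
    also have "\<dots> \<le> \<gamma> * (X - t0)"
      using inc gamma_pos by simp
    finally show ?thesis .
  qed
  have "W z \<le> (t0 + l * (X - t0)) + \<gamma> * (t0 + l * (X - t0))\<^sup>2"
    unfolding W_def
  proof (rule quadratic_correction_mono[OF wz wN[OF zn] _ N(2)])
    have "0 \<le> l * (X - t0)" "l * (X - t0) \<le> 1 * (X - t0)"
      using l inc gb by (auto intro!: mult_right_mono)
    moreover have "\<bar>t0 + q\<bar> \<le> N" if "0 \<le> q" "q \<le> 1 * (X - t0)" for q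
      using that t0N XN by (auto simp: abs_le_iff)
    ultimately show "\<bar>t0 + l * (X - t0)\<bar> \<le> N"
      by blast
  qed (use gamma_pos in simp)
  moreover have "2 * (t0 + l * (X - t0) + \<gamma> * (t0 + l * (X - t0))\<^sup>2) <
      (t0 + (X - t0) + \<gamma> * (t0 + (X - t0))\<^sup>2) + (t0 + \<gamma> * t0\<^sup>2)"
    using inc gb by (intro quadratic_correction_gain[OF t0N N(2) gamma_pos _ l gain]) auto
  moreover have "X + \<gamma> * X\<^sup>2 \<le> Max (interp \<T> W ` stencil \<epsilon> S z)"
  proof -
    have "X \<in> interp \<T> w ` stencil \<epsilon> S z"
      unfolding X_def using st_fin by (intro Max_in) auto
    then obtain x where x: "x \<in> stencil \<epsilon> S z" "X = interp \<T> w x" by blast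
    have "X + \<gamma> * X\<^sup>2 \<le> interp \<T> W x"
      unfolding W_def x(2) using st x(1) gamma_pos by (intro interp_quadratic_ge[OF T]) auto
    also have "\<dots> \<le> Max (interp \<T> W ` stencil \<epsilon> S z)"
      using st_fin x(1) by (intro Max_ge) auto
    finally show ?thesis .
  qed
  moreover have "t0 + \<gamma> * t0\<^sup>2 \<le> Min (interp \<T> W ` stencil \<epsilon> S z)"
  proof -
    have "t0 + \<gamma> * t0\<^sup>2 \<le> interp \<T> W x" if x: "x \<in> stencil \<epsilon> S z" for x
    proof (rule interp_ge[OF T])
      show "x \<in> (\<Union>V\<in>\<T>. convex hull V)"
        using st x by blast
      fix v assume v: "v \<in> mesh_nodes \<T>" "dist x v \<le> mesh_size \<T>"
      have "dist z x \<le> \<epsilon>"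
        using x Ssub h(3) by (auto simp: stencil_def dist_norm)
      then have "t0 \<le> w v"
        unfolding t0_def w_def using v(2) dist_triangle[of v z x]
        by (intro patch_sup_ge[OF N(1) zcl]) (simp add: dist_commute)
      then show "t0 + \<gamma> * t0\<^sup>2 \<le> W v"
        unfolding W_def using gamma_pos by (intro quadratic_correction_mono[OF _ t0N wN[OF v(1)] N(2)]) auto
    qed
    then show ?thesis
      using st_fin by (intro Min.boundedI) auto
  qed
  ultimately show ?thesis
    by simp
qed

text \<open>The error terms are, in order: the boundary mismatch, the passage from u to maxima over
  radius at most 2\<epsilon>, the quadratic correction, and the return from \<open>patch\<close> to
  u.\<close>

lemma node_estimate:
  assumes T: "conforming_mesh \<T>" and inner: "inner_set \<Omega> (mesh_size \<T>) \<subseteq> mesh_domain \<T>"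
    and sub_dom: "mesh_domain \<T> \<subseteq> \<Omega>"
    and h: "0 \<le> mesh_size \<T>" "mesh_size \<T> \<le> \<epsilon>" "\<epsilon> > 0" and th: "0 \<le> \<theta>" "\<theta> \<le> 1"
    and S: "direction_set \<theta> S"
    and r1: "5 * (\<epsilon> + mesh_size \<T>) \<le> 3 * (2 * \<epsilon> - \<epsilon> * \<theta>)"
    and r2: "8 * (2 * mesh_size \<T> + \<epsilon> * \<theta>) < \<gamma>\<^sup>2 * (2 * \<epsilon> - \<epsilon> * \<theta>)\<^sup>2"
    and u: "holder_bounded (closure \<Omega>) \<alpha> M u" "\<alpha> \<ge> 0"
    and small: "2 * \<gamma> * diameter \<Omega> \<le> 1" "2 * \<gamma> * (M + 1) \<le> 1"
    and U: "discrete_solution \<Omega> \<T> \<epsilon> S (\<lambda>_. 0) g U"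
    and bdry: "\<And>z. z \<in> boundary_nodes \<Omega> \<T> \<epsilon> \<Longrightarrow> u z \<le> U z + B"
    and z: "z \<in> mesh_nodes \<T>"
  shows "u z \<le> U z + B + M * (2 * \<epsilon>) powr \<alpha> + \<gamma> * (M + 1)\<^sup>2 + 2 * \<gamma> * diameter \<Omega>"
proof -
  have uM: "\<bar>u x\<bar> \<le> M" and uH: "\<bar>u x - u y\<bar> \<le> M * dist x y powr \<alpha>"
    if "x \<in> closure \<Omega>" "y \<in> closure \<Omega>" for x y
    using u(1) that unfolding holder_bounded_def by blast+
  have N: "\<forall>y\<in>closure \<Omega>. \<bar>patch y\<bar> \<le> M + 1"
  proof
    fix y assume "y \<in> closure \<Omega>"
    then show "\<bar>patch y\<bar> \<le> M + 1"
      using uM[of y y] patch_le[of y] patch_ge[of y] small(1) by linarith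
  qed
  have nodes_cl: "v \<in> closure \<Omega>" if "v \<in> mesh_nodes \<T>" for v
    using mesh_nodes_in_closure[OF T] closure_mono[OF sub_dom] that by blast
  have M: "M \<ge> 0"
    using uM[OF nodes_cl[OF z] nodes_cl[OF z]] by linarith
  define w where "w = patch_sup (\<epsilon> + mesh_size \<T>)"
  define W where "W = (\<lambda>x. w x + \<gamma> * (w x)\<^sup>2)"
  have patch_w: "patch v \<le> w v" if "v \<in> mesh_nodes \<T>" for v
    unfolding w_def using patch_sup_ge[OF N nodes_cl[OF that]] h by simp
  have w_le: "w v \<le> M + 1" if "v \<in> mesh_nodes \<T>" for v
    unfolding w_def using N nodes_cl[OF that] h by (intro patch_sup_le) (auto simp: abs_le_iff)
  have w_u: "w v \<le> u v + M * (2 * \<epsilon>) powr \<alpha>" if v: "v \<in> mesh_nodes \<T>" for v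
    unfolding w_def
  proof (rule patch_sup_le[OF nodes_cl[OF v]])
    fix p assume p: "p \<in> closure \<Omega>" "dist v p \<le> \<epsilon> + mesh_size \<T>"
    have "dist v p powr \<alpha> \<le> (2 * \<epsilon>) powr \<alpha>"
      using p(2) h u(2) by (intro powr_mono2) auto
    then have "M * dist v p powr \<alpha> \<le> M * (2 * \<epsilon>) powr \<alpha>"
      using M by (rule mult_left_mono)
    then show "patch p \<le> u v + M * (2 * \<epsilon>) powr \<alpha>"
      using uH[OF nodes_cl[OF v] p(1)] patch_le[of p] by linarith
  qed (use h in auto)
  define m where "m = B + M * (2 * \<epsilon>) powr \<alpha> + \<gamma> * (M + 1)\<^sup>2"
  have "W z \<le> U z + m"
  proof (rule discrete_comparison[OF T, of S "interior_nodes \<Omega> \<T> \<epsilon>" \<epsilon>, OF _ _ _ _ _ z])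
    show "finite S"
      using S by (simp add: direction_set_def)
    show "stencil \<epsilon> S y \<subseteq> (\<Union>V\<in>\<T>. convex hull V)" if "y \<in> interior_nodes \<Omega> \<T> \<epsilon>" for y
      using that S h by (intro stencil_subset_mesh[OF inner]) (auto simp: interior_nodes_def direction_set_def)
    show "2 * W y < Max (interp \<T> W ` stencil \<epsilon> S y) + Min (interp \<T> W ` stencil \<epsilon> S y)"
      if "y \<in> interior_nodes \<Omega> \<T> \<epsilon>" for y
      unfolding W_def w_def
      by (rule patch_sup_strict_subsolution[OF T inner sub_dom h th S N small(2) r1 r2 that])
    show "2 * U y = Max (interp \<T> U ` stencil \<epsilon> S y) + Min (interp \<T> U ` stencil \<epsilon> S y)"
      if "y \<in> interior_nodes \<Omega> \<T> \<epsilon>" for y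
      using U that h(3) by (auto simp: discrete_solution_def neg_disc_inf_lap_def)
    show "W y \<le> U y + m" if y: "y \<in> mesh_nodes \<T> - interior_nodes \<Omega> \<T> \<epsilon>" for y
    proof -
      have "y \<in> boundary_nodes \<Omega> \<T> \<epsilon>" "y \<in> mesh_nodes \<T>"
        using y by (auto simp: boundary_nodes_def)
      moreover have "\<bar>w y\<bar> \<le> M + 1"
        using w_le patch_w N nodes_cl y by (force simp: abs_le_iff)
      then have "(w y)\<^sup>2 \<le> (M + 1)\<^sup>2"
        using M by (intro power2_le_iff_abs_le[THEN iffD2]) auto
      then have "\<gamma> * (w y)\<^sup>2 \<le> \<gamma> * (M + 1)\<^sup>2"
        using gamma_pos by simp
      ultimately show ?thesis
        using w_u[of y] bdry[of y] unfolding W_def m_def by linarith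
    qed
  qed
  moreover have "w z \<le> W z"
    using gamma_pos by (simp add: W_def)
  ultimately show ?thesis
    using patch_w[OF z] patch_ge[of z] unfolding m_def by linarith
qed

end

lemma interp_upper_estimate:
  fixes \<Omega> :: "(real^'n) set"
  assumes dom: "open \<Omega>" "bounded \<Omega>" and sub: "inf_subharmonic \<Omega> u"
    and u: "holder_bounded (closure \<Omega>) \<alpha> M u" and \<alpha>: "0 < \<alpha>" "\<alpha> \<le> 1"
    and T: "conforming_mesh \<T>" and inner: "inner_set \<Omega> (mesh_size \<T>) \<subseteq> mesh_domain \<T>"
    and sub_dom: "mesh_domain \<T> \<subseteq> \<Omega>"
    and h: "0 \<le> mesh_size \<T>" "mesh_size \<T> \<le> \<epsilon>" "\<epsilon> > 0" "\<epsilon> \<le> 2 / 5" and th: "0 < \<theta>" "\<theta> \<le> 2 / 5"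
    and S: "direction_set \<theta> S"
  defines "\<kappa> \<equiv> (2 * mesh_size \<T> + \<epsilon> * \<theta>) / \<epsilon>\<^sup>2"
  assumes small: "\<kappa> \<le> 2 / 5" "4 * (M + 1 + diameter \<Omega>) * sqrt \<kappa> \<le> 1"
    and U: "discrete_solution \<Omega> \<T> \<epsilon> S (\<lambda>_. 0) g U"
    and bdry: "\<And>z. z \<in> boundary_nodes \<Omega> \<T> \<epsilon> \<Longrightarrow> u z \<le> U z + 5 * M * \<epsilon> powr \<alpha>"
    and x: "x \<in> mesh_domain \<T>"
  shows "u x \<le> interp \<T> U x + 8 * M * \<epsilon> powr \<alpha> + (2 * (M + 1)\<^sup>2 + 4 * diameter \<Omega>) * sqrt \<kappa>"
proof -
  have uM: "\<bar>u x\<bar> \<le> M" and uH: "\<bar>u x - u y\<bar> \<le> M * dist x y powr \<alpha>"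
    if "x \<in> closure \<Omega>" "y \<in> closure \<Omega>" for x y
    using u(1) that unfolding holder_bounded_def by blast+
  have xcl: "x \<in> closure \<Omega>"
    using x sub_dom closure_subset by blast
  have M: "M \<ge> 0"
    using uM[OF xcl xcl] by linarith
  have diam: "diameter \<Omega> \<ge> 0"
    by (rule diameter_ge_0[OF dom(2)])
  have et: "\<epsilon> * \<theta> > 0" "\<epsilon> * \<theta> \<le> \<epsilon> * (2 / 5)"
    using h th by (auto intro: mult_left_mono)
  have kappa: "\<kappa> > 0" and num: "2 * mesh_size \<T> + \<epsilon> * \<theta> = \<kappa> * \<epsilon>\<^sup>2"
    using et h by (auto simp: \<kappa>_def intro!: divide_pos_pos)
  have sq: "sqrt \<kappa> > 0"
    using kappa by simp
  \<comment> \<open>Since \<theta> \<le> 2/5, the square of 2\<epsilon> - \<epsilon>\<theta> is at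
    least 64/25 \<epsilon>^2 > 2 \<epsilon>^2, so \<gamma>^2 = 4\<kappa> suffices for the strict
    inequality \<open>r2\<close>.\<close>
  define \<gamma> where "\<gamma> = 2 * sqrt \<kappa>"
  have g2: "\<gamma>\<^sup>2 = 4 * \<kappa>"
    using kappa by (simp add: \<gamma>_def power_mult_distrib)
  interpret slope_patch \<Omega> u \<gamma>
  proof
    show "continuous_on (closure \<Omega>) u"
      using u by (simp add: holder_bounded_def)
    show "\<gamma> > 0"
      using sq by (simp add: \<gamma>_def)
  qed (use dom sub in auto)
  \<comment> \<open>This amounts to the weight bound l \<le> 3/5; it holds because \<kappa>
    \<epsilon> = (2h + \<epsilon>\<theta>)/\<epsilon> is small.\<close>
  have r1: "5 * (\<epsilon> + mesh_size \<T>) \<le> 3 * (2 * \<epsilon> - \<epsilon> * \<theta>)"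
  proof -
    have "\<kappa> * \<epsilon> \<le> 2 / 5 * (2 / 5)"
      using small(1) kappa h by (intro mult_mono) auto
    then have "3 * (\<kappa> * \<epsilon>) * \<epsilon> \<le> 1 * \<epsilon>"
      using h by (intro mult_right_mono) auto
    then have "3 * (2 * mesh_size \<T> + \<epsilon> * \<theta>) \<le> \<epsilon>"
      unfolding num by (simp add: power2_eq_square)
    then show ?thesis
      using h(1) by simp
  qed
  have r2: "8 * (2 * mesh_size \<T> + \<epsilon> * \<theta>) < \<gamma>\<^sup>2 * (2 * \<epsilon> - \<epsilon> * \<theta>)\<^sup>2"
  proof -
    have "(8 / 5 * \<epsilon>)\<^sup>2 \<le> (2 * \<epsilon> - \<epsilon> * \<theta>)\<^sup>2"
      using et h by (intro power_mono) auto
    then have "64 / 25 * \<epsilon>\<^sup>2 \<le> (2 * \<epsilon> - \<epsilon> * \<theta>)\<^sup>2"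
      by (simp add: power2_eq_square)
    moreover have "\<epsilon>\<^sup>2 > 0"
      using h by simp
    ultimately have "2 * \<epsilon>\<^sup>2 < (2 * \<epsilon> - \<epsilon> * \<theta>)\<^sup>2"
      by linarith
    then have "4 * \<kappa> * (2 * \<epsilon>\<^sup>2) < 4 * \<kappa> * (2 * \<epsilon> - \<epsilon> * \<theta>)\<^sup>2"
      using kappa by (intro mult_strict_left_mono) auto
    then show ?thesis
      unfolding num g2 by simp
  qed
  have Ms: "0 \<le> M * sqrt \<kappa>" and ds: "0 \<le> diameter \<Omega> * sqrt \<kappa>"
    using M diam sq by auto
  have small': "2 * \<gamma> * diameter \<Omega> \<le> 1" "2 * \<gamma> * (M + 1) \<le> 1"
  proof -
    have "4 * (M * sqrt \<kappa>) + 4 * sqrt \<kappa> + 4 * (diameter \<Omega> * sqrt \<kappa>) \<le> 1"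
      using small(2) by (simp add: algebra_simps)
    then have "4 * (diameter \<Omega> * sqrt \<kappa>) \<le> 1" "4 * (M * sqrt \<kappa>) + 4 * sqrt \<kappa> \<le> 1"
      using Ms ds sq by linarith+
    then show "2 * \<gamma> * diameter \<Omega> \<le> 1" "2 * \<gamma> * (M + 1) \<le> 1"
      unfolding \<gamma>_def by (simp_all add: algebra_simps)
  qed
  have two: "2 powr \<alpha> \<le> 2 powr 1"
    using \<alpha> by (intro powr_mono) auto
  have "(2 * \<epsilon>) powr \<alpha> \<le> 2 * \<epsilon> powr \<alpha>"
    using two h by (simp add: powr_mult mult_right_mono)
  then have pow2: "M * (2 * \<epsilon>) powr \<alpha> \<le> 2 * M * \<epsilon> powr \<alpha>"
    using M mult_left_mono by fastforce
  \<comment> \<open>The 7 consists of 5 from the boundary data and 2 from the maxima; moving from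
    the nodes to x adds one more.\<close>
  define E where "E = 7 * M * \<epsilon> powr \<alpha> + (2 * (M + 1)\<^sup>2 + 4 * diameter \<Omega>) * sqrt \<kappa>"
  have node: "u z \<le> U z + E" if z: "z \<in> mesh_nodes \<T>" for z
  proof -
    have "u z \<le> U z + 5 * M * \<epsilon> powr \<alpha> + M * (2 * \<epsilon>) powr \<alpha> + \<gamma> * (M + 1)\<^sup>2 + 2 * \<gamma> * diameter \<Omega>"
      using h th \<alpha> by (intro node_estimate[OF T inner sub_dom h(1-3) _ _ S r1 r2 u _ small' U bdry z]) auto
    then show ?thesis
      using pow2 unfolding E_def \<gamma>_def by (simp add: algebra_simps)
  qed
  have "u x - M * \<epsilon> powr \<alpha> - E \<le> interp \<T> U x"
  proof (rule interp_ge[OF T])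
    show "x \<in> (\<Union>V\<in>\<T>. convex hull V)"
      using x interior_subset unfolding mesh_domain_def by blast
    fix v assume v: "v \<in> mesh_nodes \<T>" "dist x v \<le> mesh_size \<T>"
    have "dist x v powr \<alpha> \<le> \<epsilon> powr \<alpha>"
      using v(2) h \<alpha> by (intro powr_mono2) auto
    then have "M * dist x v powr \<alpha> \<le> M * \<epsilon> powr \<alpha>"
      using M by (rule mult_left_mono)
    moreover have "v \<in> closure \<Omega>"
      using mesh_nodes_in_closure[OF T] closure_mono[OF sub_dom] v(1) by blast
    ultimately show "u x - M * \<epsilon> powr \<alpha> - E \<le> U v"
      using uH[OF xcl, of v] node[OF v(1)] by linarith
  qed
  then show ?thesis
    unfolding E_def by (simp add: algebra_simps)
qed

section \<open>Boundary data and change of sign\<close>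

lemma dist_boundary_node_frontier:
  assumes "bounded \<Omega>" "conforming_mesh \<T>" "mesh_domain \<T> \<subseteq> \<Omega>" "\<Omega> \<noteq> {}" "\<epsilon> > 0"
    and z: "z \<in> boundary_nodes \<Omega> \<T> \<epsilon>"
  shows "\<exists>x\<in>frontier \<Omega>. dist z x \<le> 2 * \<epsilon>"
proof (cases "z \<in> \<Omega>")
  case True
  have "\<Omega> \<noteq> UNIV"
    using assms(1) not_bounded_UNIV by metis
  then have "frontier \<Omega> \<noteq> {}"
    using assms(4) by (simp add: frontier_eq_empty)
  then obtain x where "x \<in> frontier \<Omega>" "infdist z (frontier \<Omega>) = dist z x"
    using infdist_attains_inf[of "frontier \<Omega>" z] by auto
  moreover have "infdist z (frontier \<Omega>) \<le> 2 * \<epsilon>"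
    using z True by (auto simp: boundary_nodes_def interior_nodes_def inner_set_def)
  ultimately show ?thesis
    by auto
next
  case False
  have "z \<in> closure \<Omega>"
    using mesh_nodes_in_closure[OF assms(2)] closure_mono[OF assms(3)] z by (auto simp: boundary_nodes_def)
  then have "z \<in> frontier \<Omega>"
    using False interior_subset by (auto simp: frontier_def)
  then show ?thesis
    using assms(5) by (intro bexI[of _ z]) auto
qed

text \<open>Between z and x both u and \<open>gt\<close> vary by at most 2 M \<epsilon>^\<alpha>, as
  (2\<epsilon>)^\<alpha> \<le> 2 \<epsilon>^\<alpha>; the mismatch at x adds one more, which makes
  5.\<close>

lemma boundary_data_error:
  assumes z: "z \<in> closure \<Omega>" and x: "x \<in> frontier \<Omega>" "dist z x \<le> 2 * \<epsilon>"
    and u: "holder_bounded (closure \<Omega>) \<alpha> M u" and g: "holder_bounded (closure \<Omega>) \<alpha> M gt"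
    and \<alpha>: "0 < \<alpha>" "\<alpha> \<le> 1" and e: "\<epsilon> > 0" and close: "\<bar>u x - gt x\<bar> \<le> M * \<epsilon> powr \<alpha>"
  shows "\<bar>u z - gt z\<bar> \<le> 5 * M * \<epsilon> powr \<alpha>"
proof -
  have xcl: "x \<in> closure \<Omega>"
    using x(1) by (simp add: frontier_def)
  have M: "M \<ge> 0"
    using u z unfolding holder_bounded_def by force
  have two: "2 powr \<alpha> \<le> 2 powr 1"
    using \<alpha> by (intro powr_mono) auto
  have "dist z x powr \<alpha> \<le> (2 * \<epsilon>) powr \<alpha>"
    using x(2) \<alpha> by (intro powr_mono2) auto
  also have "\<dots> \<le> 2 * \<epsilon> powr \<alpha>"
    using two e by (simp add: powr_mult mult_right_mono)
  finally have "M * dist z x powr \<alpha> \<le> M * (2 * \<epsilon> powr \<alpha>)"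
    using M by (rule mult_left_mono)
  moreover have "\<bar>u z - u x\<bar> \<le> M * dist z x powr \<alpha>" "\<bar>gt z - gt x\<bar> \<le> M * dist z x powr \<alpha>"
    using u g z xcl unfolding holder_bounded_def by blast+
  ultimately show ?thesis
    using close by linarith
qed

lemma holder_bounded_uminus: "holder_bounded S \<alpha> M u \<Longrightarrow> holder_bounded S \<alpha> M (\<lambda>x. - u x)"
  unfolding holder_bounded_def by (auto intro: continuous_on_minus simp: abs_minus_commute)

text \<open>Negation exchanges maximum and minimum, so the discrete operator is odd wherever the
  stencil stays in the mesh.\<close>

lemma discrete_solution_uminus:
  assumes T: "conforming_mesh \<T>" and S: "finite S"
    and st: "\<And>z. z \<in> interior_nodes \<Omega> \<T> \<epsilon> \<Longrightarrow> stencil \<epsilon> S z \<subseteq> (\<Union>V\<in>\<T>. convex hull V)"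
    and U: "discrete_solution \<Omega> \<T> \<epsilon> S (\<lambda>_. 0) g U"
  shows "discrete_solution \<Omega> \<T> \<epsilon> S (\<lambda>_. 0) (\<lambda>x. - g x) (\<lambda>x. - U x)"
proof -
  have "neg_disc_inf_lap \<T> \<epsilon> S (\<lambda>x. - U x) z = - neg_disc_inf_lap \<T> \<epsilon> S U z"
    if z: "z \<in> interior_nodes \<Omega> \<T> \<epsilon>" for z
  proof -
    define A where "A = interp \<T> U ` stencil \<epsilon> S z"
    have A: "finite A" "A \<noteq> {}"
      using S by (auto simp: A_def stencil_def)
    have "interp \<T> (\<lambda>x. - U x) ` stencil \<epsilon> S z = uminus ` A"
      unfolding A_def image_image using st[OF z] by (intro image_cong refl interp_uminus[OF T]) auto
    moreover have "Max (uminus ` A) = - Min A" "Min (uminus ` A) = - Max A"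
      using A by (simp_all add: minus_Max_eq_Min minus_Min_eq_Max)
    ultimately have "neg_disc_inf_lap \<T> \<epsilon> S (\<lambda>x. - U x) z = (2 * - U z - - Min A - - Max A) / \<epsilon>\<^sup>2"
      unfolding neg_disc_inf_lap_def by simp
    also have "\<dots> = - ((2 * U z - Max A - Min A) / \<epsilon>\<^sup>2)"
      unfolding minus_divide_left by (rule arg_cong[of _ _ "\<lambda>y. y / \<epsilon>\<^sup>2"]) simp
    finally show ?thesis
      unfolding neg_disc_inf_lap_def A_def .
  qed
  then show ?thesis
    using U unfolding discrete_solution_def by simp
qed

theorem theorem4p3:
  fixes \<Omega> :: "(real^'n) set" and \<alpha> \<sigma> q M :: real
  assumes "bounded_domain_cb \<Omega>"
    and "0 < \<alpha>" "\<alpha> \<le> 1"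
  shows "\<exists>C \<delta>. \<delta> > 0 \<and>
    (\<forall>(g :: real^'n \<Rightarrow> real) (gt :: real \<Rightarrow> real^'n \<Rightarrow> real) (u :: real^'n \<Rightarrow> real)
       (\<T> :: (real^'n) set set) (\<epsilon> :: real) (\<theta> :: real) (S :: (real^'n) set) (U :: real^'n \<Rightarrow> real).
      \<comment> \<open>(BC.1) and g \<in> C^{0,alpha}(boundary)\<close>
      continuous_on (frontier \<Omega>) g \<and> holder_bounded (frontier \<Omega>) \<alpha> M g \<and>
      \<comment> \<open>(BC.2)\<close>
      (\<forall>e>0. continuous_on (closure \<Omega>) (gt e) \<and> holder_bounded (closure \<Omega>) \<alpha> M (gt e) \<and>
         (\<forall>x\<in>frontier \<Omega>. \<bar>g x - gt e x\<bar> \<le> M * e powr \<alpha>)) \<and>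
      \<comment> \<open>u viscosity solution with f = 0, u \<in> C^{0,alpha}(closure)\<close>
      viscosity_solution \<Omega> (\<lambda>_. 0) g u \<and> holder_bounded (closure \<Omega>) \<alpha> M u \<and>
      \<comment> \<open>mesh\<close>
      conforming_mesh \<T> \<and> shape_regular \<sigma> \<T> \<and> quasi_uniform q \<T> \<and>
      inner_set \<Omega> (mesh_size \<T>) \<subseteq> mesh_domain \<T> \<and> mesh_domain \<T> \<subseteq> \<Omega> \<and>
      \<comment> \<open>parameters\<close>
      mesh_size \<T> \<le> \<epsilon> \<and> \<epsilon> \<le> diameter \<Omega> \<and> 0 < \<theta> \<and> \<theta> \<le> 1 \<and> direction_set \<theta> S \<and>
      mesh_size \<T> < \<delta> \<and> \<epsilon> < \<delta> \<and> \<theta> < \<delta> \<and>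
      \<epsilon> - \<epsilon> * \<theta> - mesh_size \<T> > 0 \<and>
      (2 * mesh_size \<T> + \<epsilon> * \<theta>) / \<epsilon>\<^sup>2 < \<delta> \<and>
      \<comment> \<open>(M.1) and the discrete solution\<close>
      cond_M1 \<Omega> \<T> \<epsilon> S \<and>
      discrete_solution \<Omega> \<T> \<epsilon> S (\<lambda>_. 0) (gt \<epsilon>) U
      \<longrightarrow> (\<forall>x\<in>mesh_domain \<T>.
            \<bar>u x - interp \<T> U x\<bar> \<le> C * (\<epsilon> powr \<alpha> + sqrt (2 * mesh_size \<T> + \<epsilon> * \<theta>) / \<epsilon>)))"
proof -
  define D where "D = diameter \<Omega>"
  \<comment> \<open>The choice \<delta> \<le> 1/K^2 yields K sqrt \<kappa> \<le> 1; with \<gamma> =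
    2 sqrt \<kappa> this keeps the patching loss below 1 and the quadratic correction monotone.
    Absolute values appear because M \<ge> 0 is known only once some u is given.\<close>
  define K where "K = 4 * (\<bar>M\<bar> + 1 + D)"
  define C where "C = 8 * \<bar>M\<bar> + 2 * (\<bar>M\<bar> + 1)\<^sup>2 + 4 * D"
  define \<delta> where "\<delta> = min (2 / 5) (1 / K\<^sup>2)"
  have dom: "open \<Omega>" "bounded \<Omega>" "\<Omega> \<noteq> {}"
    using assms(1) by (auto simp: bounded_domain_cb_def)
  have D: "D \<ge> 0"
    unfolding D_def by (rule diameter_ge_0[OF dom(2)])
  have K: "K > 0"
    using D by (simp add: K_def)
  have delta: "\<delta> > 0"
    using K by (simp add: \<delta>_def)
  have main: "\<bar>u x - interp \<T> U x\<bar> \<le> C * (\<epsilon> powr \<alpha> + sqrt (2 * mesh_size \<T> + \<epsilon> * \<theta>) / \<epsilon>)"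
    if gt: "\<forall>e>0. continuous_on (closure \<Omega>) (gt e) \<and> holder_bounded (closure \<Omega>) \<alpha> M (gt e) \<and>
         (\<forall>x\<in>frontier \<Omega>. \<bar>g x - gt e x\<bar> \<le> M * e powr \<alpha>)"
      and visc: "viscosity_solution \<Omega> (\<lambda>_. 0) g u" and u: "holder_bounded (closure \<Omega>) \<alpha> M u"
      and T: "conforming_mesh \<T>"
      and inner: "inner_set \<Omega> (mesh_size \<T>) \<subseteq> mesh_domain \<T>" and sub_dom: "mesh_domain \<T> \<subseteq> \<Omega>"
      and h: "mesh_size \<T> \<le> \<epsilon>" and th: "0 < \<theta>" "\<theta> \<le> 1" and S: "direction_set \<theta> S"
      and small: "\<epsilon> < \<delta>" "\<theta> < \<delta>" "(2 * mesh_size \<T> + \<epsilon> * \<theta>) / \<epsilon>\<^sup>2 < \<delta>"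
      and gap: "\<epsilon> - \<epsilon> * \<theta> - mesh_size \<T> > 0"
      and U: "discrete_solution \<Omega> \<T> \<epsilon> S (\<lambda>_. 0) (gt \<epsilon>) U" and x: "x \<in> mesh_domain \<T>"
    for g gt u \<T> \<epsilon> \<theta> S U x
  proof -
    define \<kappa> where "\<kappa> = (2 * mesh_size \<T> + \<epsilon> * \<theta>) / \<epsilon>\<^sup>2"
    have xT: "x \<in> (\<Union>V\<in>\<T>. convex hull V)"
      using x interior_subset unfolding mesh_domain_def by blast
    have xcl: "x \<in> closure \<Omega>"
      using x sub_dom closure_subset by blast
    have M: "M \<ge> 0"
      using u xcl unfolding holder_bounded_def by force
    have h0: "0 \<le> mesh_size \<T>"
    proof -
      obtain V where V: "V \<in> \<T>" "x \<in> convex hull V"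
        using xT by blast
      then obtain v where "v \<in> V"
        by (cases "V = {}") auto
      then show ?thesis
        using dist_vertex_le_mesh_size[OF T V(1) _ V(2)] order_trans[OF zero_le_dist] by blast
    qed
    \<comment> \<open>The gap condition says \<epsilon> (1 - \<theta>) > h \<ge> 0, and 1 - \<theta>
      is nonnegative.\<close>
    have e: "\<epsilon> > 0"
    proof (rule ccontr)
      assume "\<not> \<epsilon> > 0"
      then have "\<epsilon> * (1 - \<theta>) \<le> 0"
        using th by (intro mult_nonpos_nonneg) auto
      then show False
        using gap h0 by (simp add: right_diff_distrib)
    qed
    have kappa: "\<kappa> > 0" "\<kappa> < \<delta>"
      using h0 e th small(3) by (auto simp: \<kappa>_def intro!: divide_pos_pos add_nonneg_pos)
    have sqk: "sqrt \<kappa> = sqrt (2 * mesh_size \<T> + \<epsilon> * \<theta>) / \<epsilon>"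
      using e by (simp add: \<kappa>_def real_sqrt_divide)
    have "\<kappa> \<le> (1 / K)\<^sup>2"
      using kappa(2) by (simp add: \<delta>_def power_divide)
    then have "sqrt \<kappa> \<le> 1 / K"
      using K by (intro real_le_lsqrt) (auto simp: kappa less_imp_le)
    then have k2: "4 * (M + 1 + diameter \<Omega>) * sqrt \<kappa> \<le> 1"
      using K M by (simp add: K_def D_def field_simps)
    have d25: "\<epsilon> \<le> 2 / 5" "\<theta> \<le> 2 / 5" "\<kappa> \<le> 2 / 5"
      using small(1,2) kappa(2) by (auto simp: \<delta>_def)
    have st: "stencil \<epsilon> S z \<subseteq> (\<Union>V\<in>\<T>. convex hull V)" if "z \<in> interior_nodes \<Omega> \<T> \<epsilon>" for z
      using that S h e by (intro stencil_subset_mesh[OF inner]) (auto simp: interior_nodes_def direction_set_def)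
    have bdry: "\<bar>u z - U z\<bar> \<le> 5 * M * \<epsilon> powr \<alpha>" if z: "z \<in> boundary_nodes \<Omega> \<T> \<epsilon>" for z
    proof -
      obtain y where y: "y \<in> frontier \<Omega>" "dist z y \<le> 2 * \<epsilon>"
        using dist_boundary_node_frontier[OF dom(2) T sub_dom dom(3) e z] by blast
      have "z \<in> closure \<Omega>"
        using mesh_nodes_in_closure[OF T] closure_mono[OF sub_dom] z by (auto simp: boundary_nodes_def)
      moreover have "u y = g y"
        using visc[unfolded viscosity_solution_def, THEN conjunct2, THEN conjunct1] y(1) by simp
      moreover have "U z = gt \<epsilon> z"
        using U z by (simp add: discrete_solution_def)
      ultimately show ?thesis
        using boundary_data_error[OF _ y u _ assms(2,3) e, where gt = "gt \<epsilon>"] gt e y(1) by simp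
    qed
    have "u x \<le> interp \<T> U x + 8 * M * \<epsilon> powr \<alpha> + (2 * (M + 1)\<^sup>2 + 4 * diameter \<Omega>) * sqrt \<kappa>"
      unfolding \<kappa>_def
    proof (rule interp_upper_estimate[OF dom(1,2) viscosity_solution_inf_subharmonic(1)[OF visc] u
          assms(2,3) T inner sub_dom h0 h e d25(1) th(1) d25(2) S _ _ U _ x])
      show "u z \<le> U z + 5 * M * \<epsilon> powr \<alpha>" if "z \<in> boundary_nodes \<Omega> \<T> \<epsilon>" for z
        using bdry[OF that] by linarith
    qed (use d25(3) k2 in \<open>simp_all add: \<kappa>_def\<close>)
    moreover have "- u x \<le> interp \<T> (\<lambda>y. - U y) x + 8 * M * \<epsilon> powr \<alpha> +
        (2 * (M + 1)\<^sup>2 + 4 * diameter \<Omega>) * sqrt \<kappa>"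
      unfolding \<kappa>_def
    proof (rule interp_upper_estimate[OF dom(1,2) viscosity_solution_inf_subharmonic(2)[OF visc]
          holder_bounded_uminus[OF u] assms(2,3) T inner sub_dom h0 h e d25(1) th(1) d25(2) S _ _
          discrete_solution_uminus[OF T _ st U] _ x])
      show "- u z \<le> - U z + 5 * M * \<epsilon> powr \<alpha>" if "z \<in> boundary_nodes \<Omega> \<T> \<epsilon>" for z
        using bdry[OF that] by linarith
      show "finite S"
        using S by (simp add: direction_set_def)
    qed (use d25(3) k2 in \<open>simp_all add: \<kappa>_def\<close>)
    ultimately have "\<bar>u x - interp \<T> U x\<bar> \<le> 8 * M * \<epsilon> powr \<alpha> + (2 * (M + 1)\<^sup>2 + 4 * D) * sqrt \<kappa>"
      unfolding interp_uminus[OF T xT] D_def by linarith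
    also have "\<dots> \<le> C * \<epsilon> powr \<alpha> + C * sqrt \<kappa>"
      using M D kappa(1) by (intro add_mono mult_right_mono) (auto simp: C_def)
    finally show ?thesis
      unfolding sqk by (simp add: distrib_left)
  qed
  show ?thesis
  proof (rule exI[of _ C], rule exI[of _ \<delta>], intro conjI allI impI ballI, goal_cases)
    case 1
    show ?case by (rule delta)
  next
    case (2 g gt u \<T> \<epsilon> \<theta> S U x)
    then show ?case
      by (elim conjE) (rule main[of gt g u]; assumption)
  qed
qed

end
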